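(* Suppose $h\in\mathbb{R}[x_1,\ldots,x_n]$ is hyperbolic with respect to $\mathbf{e}\in\mathbb{R}^n$ and suppose $\mathbf{v}_1,\ldots,\mathbf{v}_m\in\Lambda_+(\mathbf{e})$ are such that $\mathbf{e}=\mathbf{v}_1+\cdots+\mathbf{v}_m$ and $\operatorname{tr}(\mathbf{v}_j)\leq\epsilon$ for each $1\leq j\leq m$. Then the largest zero of the polynomial $t\mapsto h[\mathbf{v}_1,\ldots,\mathbf{v}_m](t\mathbf{e}+\mathbf{1})$ is at most $$\delta(\epsilon,m):=\Big(1-\frac1m+\sqrt{\epsilon-\frac1m\Big(1-\frac1m\Big)}\Big)^2.$$
   Context: A homogeneous polynomial $h$ of degree $d$ is hyperbolic with respect to $\mathbf{e}\in\mathbb{R}^n$ if $h(\mathbf{e})\neq0$ and for every $\mathbf{x}$, $t\mapsto h(t\mathbf{e}-\mathbf{x})$ has only real zeros; writing $h(t\mathbf{e}-\mathbf{x})=h(\mathbf{e})\prod_{j=1}^d(t-\lambda_j(\mathbf{x}))$ defines the eigenvalues. $\Lambda_+(\mathbf{e})=\{\mathbf{x}:\min_j\lambda_j(\mathbf{x})\geq0\}$, $\operatorname{tr}(\mathbf{x})=\sum_j\lambda_j(\mathbf{x})$. $D_{\mathbf{v}}=\sum_kv_k\partial/\partial x_k$, and $h[\mathbf{v}_1,\ldots,\mathbf{v}_m]:=\prod_{j=1}^m(1-y_jD_{\mathbf{v}_j})h(\mathbf{x})\in\mathbb{R}[x_1,\ldots,x_n,y_1,\ldots,y_m]$. Here $t\mathbf{e}+\mathbf{1}$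 denotes the point $(t\mathbf{e},1,\ldots,1)\in\mathbb{R}^n\oplus\mathbb{R}^m$, i.e. $\mathbf{x}=t\mathbf{e}$ and $y_1=\cdots=y_m=1$. *)

theory Defs
  imports "HOL-Analysis.Analysis" "HOL-Computational_Algebra.Polynomial"
begin

text \<open>A real polynomial in the variables indexed by the finite type 'n is represented by its
  coefficient function on exponent vectors (monomials); only finitely many coefficients are nonzero.\<close>

definition mpoly_eval :: "(('n::finite \<Rightarrow> nat) \<Rightarrow> real) \<Rightarrow> real^'n \<Rightarrow> real" where
  "mpoly_eval c x = (\<Sum>\<alpha>\<in>{\<alpha>. c \<alpha> \<noteq> 0}. c \<alpha> * (\<Prod>i\<in>UNIV. (x $ i) ^ \<alpha> i))"

definition homogeneous_poly :: "(('n::finite \<Rightarrow> nat) \<Rightarrow> real) \<Rightarrow> nat \<Rightarrow> bool" where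
  "homogeneous_poly c d \<longleftrightarrow> finite {\<alpha>. c \<alpha> \<noteq> 0} \<and> (\<forall>\<alpha>. c \<alpha> \<noteq> 0 \<longrightarrow> (\<Sum>i\<in>UNIV. \<alpha> i) = d)"

definition char_poly :: "(('n::finite \<Rightarrow> nat) \<Rightarrow> real) \<Rightarrow> real^'n \<Rightarrow> real^'n \<Rightarrow> real poly" where
  "char_poly c e x = (\<Sum>\<alpha>\<in>{\<alpha>. c \<alpha> \<noteq> 0}. smult (c \<alpha>) (\<Prod>i\<in>UNIV. [:- (x $ i), e $ i:] ^ \<alpha> i))"

definition hyperbolic :: "(('n::finite \<Rightarrow> nat) \<Rightarrow> real) \<Rightarrow> nat \<Rightarrow> real^'n \<Rightarrow> bool" where
  "hyperbolic c d e \<longleftrightarrow> homogeneous_poly c d \<and> mpoly_eval c e \<noteq> 0 \<and>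
     (\<forall>x. \<forall>z::complex. poly (map_poly complex_of_real (char_poly c e x)) z = 0 \<longrightarrow> z \<in> \<real>)"

definition hyp_cone :: "(('n::finite \<Rightarrow> nat) \<Rightarrow> real) \<Rightarrow> real^'n \<Rightarrow> (real^'n) set" where
  "hyp_cone c e = {x. \<forall>r. poly (char_poly c e x) r = 0 \<longrightarrow> r \<ge> 0}"

definition hyp_trace :: "(('n::finite \<Rightarrow> nat) \<Rightarrow> real) \<Rightarrow> real^'n \<Rightarrow> real^'n \<Rightarrow> real" where
  "hyp_trace c e x = (\<Sum>r\<in>{r. poly (char_poly c e x) r = 0}. of_nat (order r (char_poly c e x)) * r)"

definition dir_deriv :: "real^'n \<Rightarrow> (real^'n \<Rightarrow> real) \<Rightarrow> real^'n \<Rightarrow> real" where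
  "dir_deriv v f x = deriv (\<lambda>s. f (x + s *\<^sub>R v)) 0"

text \<open>h[v_1,...,v_m] evaluated at y_1 = ... = y_m = 1, as a function of x:
  (1 - D_{v_1}) ... (1 - D_{v_m}) h.\<close>
definition mixed_op :: "(real^'n) list \<Rightarrow> (real^'n \<Rightarrow> real) \<Rightarrow> real^'n \<Rightarrow> real" where
  "mixed_op vs f = foldr (\<lambda>v g x. g x - dir_deriv v g x) vs f"

definition delta_bound :: "real \<Rightarrow> nat \<Rightarrow> real" where
  "delta_bound \<epsilon> m = (1 - 1 / real m + sqrt (\<epsilon> - 1 / real m * (1 - 1 / real m))) ^ 2"

end

theory Submission
  imports Defs "HOL-Computational_Algebra.Fundamental_Theorem_Algebra"
begin

text \<open>
  Restricting h to the span of the vectors turns the problem into one about a polynomial H in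
  z_1, \<dots>, z_m without zeros when all Im z_j > 0, and G(z, y) = \<Prod>(1 - y_j \<partial>_j) H(z) has no zeros when all
  Im z_j > 0 and all Im y_j \<le> 0. So G is hyperbolic with respect to E = (1, 0), and by Garding's
  theorem its closed hyperbolicity cone Q is convex.

  The barrier argument of Marcus, Spielman and Srivastava becomes a statement about Q: writing u_i for
  the unit vectors in the z-variables and f_i for those in the y-variables, if (z, y + \<mu> f_i) and
  (z, y + \<mu> f_j) lie in Q, where y_i = y_j = 0, then so does (z + \<nu> u_i, y + f_i + \<mu> f_j), provided that
  1/\<mu> + 1/\<nu> = 1. Starting from (\<epsilon>\<mu> 1, \<mu> f_j) and adding all indices other than j gives, for each j, the point
  (\<epsilon>\<mu> 1 + \<nu> (1 - u_j), 1 + (\<mu> - 1) f_j) of Q. Summing over j puts a multiple of (T 1, 1) in Q, where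
  T = (\<epsilon>\<mu> + (1 - 1/m) \<nu>) / (1 - 1/m + \<mu>/m), and minimizing T over \<mu> gives the bound.
\<close>

section \<open>Garding's theorem\<close>

text \<open>Membership of (z, \<mu> f_j) in Q plays the role of the usual barrier condition that the
  logarithmic derivative of H in direction j is at most 1/\<mu>; monotonicity and convexity of
  barrier functions are replaced by the orthant contained in Q and by the convexity of Q. The
  relation 1/\<mu> + 1/\<nu> = 1 says that a shift by \<nu> pays for one operator when the barrier
  is at most 1 - 1/\<nu>. A single one of the points indexed by j would give, after optimizing
  \<mu>, the bound (1 + sqrt \<epsilon>)^2; it overshoots y = 1 by \<mu> - 1 in one coordinate, and
  the sharper constant comes from averaging this surplus over j and rescaling. The main obstacle is
  to follow zeros along paths of polynomials without choosing them continuously. Absence of zeros in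
  a half-plane is therefore replaced by a lower bound for the modulus there, a closed condition that
  survives limits. Polynomials are functions generated by an inductive predicate, so that
  conjugation, continuity, restriction to lines and partial derivatives are all handled by
  induction.\<close>

inductive real_poly_fun :: "(('i \<Rightarrow> complex) \<Rightarrow> complex) \<Rightarrow> bool" where
  const: "real_poly_fun (\<lambda>X. complex_of_real c)"
| coord: "real_poly_fun (\<lambda>X. X k)"
| add: "real_poly_fun F \<Longrightarrow> real_poly_fun G \<Longrightarrow> real_poly_fun (\<lambda>X. F X + G X)"
| mult: "real_poly_fun F \<Longrightarrow> real_poly_fun G \<Longrightarrow> real_poly_fun (\<lambda>X. F X * G X)"

lemma real_poly_fun_diff:
  assumes "real_poly_fun F" "real_poly_fun G"
  shows "real_poly_fun (\<lambda>X. F X - G X)"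
proof -
  have "real_poly_fun (\<lambda>X. F X + complex_of_real (-1) * G X)"
    by (intro real_poly_fun.intros assms)
  then show ?thesis by simp
qed

lemma real_poly_fun_sum:
  "(\<And>a. a \<in> S \<Longrightarrow> real_poly_fun (F a)) \<Longrightarrow> real_poly_fun (\<lambda>X. \<Sum>a\<in>S. F a X)"
proof (induction S rule: infinite_finite_induct)
  case (insert x S)
  then show ?case by (simp add: real_poly_fun.add)
qed (use real_poly_fun.const[of 0] in simp_all)

lemma real_poly_fun_prod:
  "(\<And>a. a \<in> S \<Longrightarrow> real_poly_fun (F a)) \<Longrightarrow> real_poly_fun (\<lambda>X. \<Prod>a\<in>S. F a X)"
proof (induction S rule: infinite_finite_induct)
  case (insert x S)
  then show ?case by (simp add: real_poly_fun.mult)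
qed (use real_poly_fun.const[of 1] in simp_all)

lemma real_poly_fun_power: "real_poly_fun F \<Longrightarrow> real_poly_fun (\<lambda>X. F X ^ n)"
  by (induction n) (use real_poly_fun.const[of 1] in \<open>simp_all add: real_poly_fun.mult\<close>)

lemma real_poly_fun_subst:
  assumes "real_poly_fun F" "\<And>k. real_poly_fun (S k)"
  shows "real_poly_fun (\<lambda>X. F (\<lambda>k. S k X))"
  using assms(1) by induction (simp_all add: real_poly_fun.intros assms(2))

lemma real_poly_fun_cnj: "real_poly_fun F \<Longrightarrow> F (\<lambda>k. cnj (X k)) = cnj (F X)"
  by (induction rule: real_poly_fun.induct) simp_all

lemma real_poly_fun_of_real:
  assumes "real_poly_fun F"
  shows "F (\<lambda>k. of_real (Y k)) = of_real (Re (F (\<lambda>k. of_real (Y k))))"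
proof -
  have "cnj (F (\<lambda>k. of_real (Y k))) = F (\<lambda>k. of_real (Y k))"
    using real_poly_fun_cnj[OF assms, of "\<lambda>k. of_real (Y k)"] by simp
  then show ?thesis by (metis Reals_cnj_iff of_real_Re)
qed

lemma real_poly_fun_continuous_on:
  assumes "real_poly_fun F" "\<And>k. continuous_on S (\<lambda>t. X t k)"
  shows "continuous_on S (\<lambda>t. F (X t))"
  using assms(1) by induction (auto intro!: continuous_intros assms(2))

lemma real_poly_fun_line:
  assumes "real_poly_fun F"
  shows "\<exists>p. \<forall>r. F (\<lambda>k. U k + r * V k) = poly p r"
  using assms
proof induction
  case (const c)
  show ?case by (rule exI[of _ "[:complex_of_real c:]"]) simp
next
  case (coord k)
  show ?case by (rule exI[of _ "[:U k, V k:]"]) simp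
next
  case (add F G)
  then show ?case by (metis poly_add)
next
  case (mult F G)
  then show ?case by (metis poly_mult)
qed

section \<open>Homogeneity and the location of zeros along lines\<close>

definition homog :: "nat \<Rightarrow> (('i \<Rightarrow> complex) \<Rightarrow> complex) \<Rightarrow> bool" where
  "homog d F \<longleftrightarrow> (\<forall>r X. r \<noteq> 0 \<longrightarrow> F (\<lambda>k. r * X k) = r ^ d * F X)"

lemma homogD: "homog d F \<Longrightarrow> r \<noteq> 0 \<Longrightarrow> F (\<lambda>k. r * X k) = r ^ d * F X"
  unfolding homog_def by blast

text \<open>Homogeneity gives F(U + r V) = r^d F(V + U/r), so the line polynomial is, up to a power
  of r, the reversal of the polynomial q of the line V + r U. Its top coefficient is therefore q(0)
  = F(V).\<close>

lemma homog_line_poly: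
  assumes F: "real_poly_fun F" and h: "homog d F" and V: "F V \<noteq> 0"
  obtains p where "degree p = d" "lead_coeff p = F V" "\<And>r. F (\<lambda>k. U k + r * V k) = poly p r"
proof -
  obtain p where p: "\<And>r. F (\<lambda>k. U k + r * V k) = poly p r"
    using real_poly_fun_line[OF F] by metis
  obtain q where q: "\<And>r. F (\<lambda>k. V k + r * U k) = poly q r"
    using real_poly_fun_line[OF F] by metis
  have q0: "coeff q 0 = F V"
    using q[of 0] by (simp add: poly_0_coeff_0)
  define N where "N = degree q"
  \<comment> \<open>The factor \<open>monom 1 N\<close> clears denominators, since
    \<open>reflect_poly q\<close> takes the value r^N q(1/r).\<close>
  have eq: "poly (monom 1 N * p) r = poly (monom 1 d * reflect_poly q) r" if "r \<noteq> 0" for r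
  proof -
    have "U k + r * V k = r * (V k + inverse r * U k)" for k
      using that by (simp add: field_simps)
    then have "poly p r = F (\<lambda>k. r * (V k + inverse r * U k))"
      by (simp add: p[symmetric])
    also have "\<dots> = r ^ d * poly q (inverse r)"
      using homogD[OF h that] q by simp
    finally show ?thesis
      using that by (simp add: poly_monom poly_reflect_poly_nz N_def)
  qed
  have "infinite (- {0 :: complex})"
    by (simp add: infinite_UNIV_char_0 Compl_eq_Diff_UNIV)
  moreover have "- {0} \<subseteq> {r. poly (monom 1 N * p - monom 1 d * reflect_poly q) r = 0}"
    using eq by auto
  ultimately have "monom 1 N * p - monom 1 d * reflect_poly q = 0"
    by (metis poly_roots_finite infinite_super)
  then have meq: "monom 1 N * p = monom 1 d * reflect_poly q" by simp
  have q_ne: "q \<noteq> 0" using q0 V by auto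
  then have p_ne: "p \<noteq> 0" using meq by auto
  have "N + degree p = d + degree (reflect_poly q)"
    using arg_cong[OF meq, of degree] p_ne q_ne by (simp add: degree_mult_eq degree_monom_eq)
  then have "degree p = d"
    using q0 V by (simp add: degree_reflect_poly_eq N_def)
  moreover have "lead_coeff p = lead_coeff (reflect_poly q)"
    using arg_cong[OF meq, of lead_coeff] by (simp add: lead_coeff_mult degree_monom_eq)
  then have "lead_coeff p = F V"
    using q0 V by (simp add: coeff_reflect_poly degree_reflect_poly_eq)
  ultimately show thesis using p that by blast
qed

text \<open>In the product over the zeros each |t - \<rho>| is at least Re (\<omega> (t - \<rho>))
  \<ge> Re (\<omega> t). Unlike mere absence of zeros, this bound passes to limits of polynomials
  with fixed degree and leading coefficient, and so does the work of Hurwitz's theorem.\<close>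

lemma poly_half_plane_lower_bound:
  fixes p :: "complex poly"
  assumes "\<And>\<rho>. poly p \<rho> = 0 \<Longrightarrow> Re (\<omega> * \<rho>) \<le> 0" "norm \<omega> = 1" "Re (\<omega> * t) \<ge> 0"
  shows "norm (lead_coeff p) * Re (\<omega> * t) ^ degree p \<le> norm (poly p t)"
  using assms(1)
proof (induction "degree p" arbitrary: p)
  case 0
  then show ?case by (metis degree_0_id mult.right_neutral order_refl poly_const_conv power_0)
next
  case (Suc n)
  have "\<not> constant (poly p)"
    using Suc.hyps(2) by (simp add: constant_degree)
  then obtain \<rho> where \<rho>: "poly p \<rho> = 0"
    using fundamental_theorem_of_algebra by blast
  then obtain q where q: "p = [:-\<rho>, 1:] * q"
    by (metis dvdE poly_eq_0_iff_dvd)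
  have "q \<noteq> 0" using Suc.hyps(2) q by auto
  then have deg: "degree p = Suc (degree q)"
    unfolding q by (subst degree_mult_eq) auto
  have lc: "lead_coeff p = lead_coeff q"
    unfolding q by (simp only: lead_coeff_mult) simp
  have IH: "norm (lead_coeff q) * Re (\<omega> * t) ^ degree q \<le> norm (poly q t)"
    using Suc.hyps Suc.prems deg q by auto
  have "Re (\<omega> * t) \<le> Re (\<omega> * (t - \<rho>))"
    using Suc.prems[OF \<rho>] by (simp add: algebra_simps)
  also have "\<dots> \<le> norm (t - \<rho>)"
    using complex_Re_le_cmod[of "\<omega> * (t - \<rho>)"] assms(2) by (simp add: norm_mult)
  finally have "Re (\<omega> * t) * (norm (lead_coeff q) * Re (\<omega> * t) ^ degree q)
      \<le> norm (t - \<rho>) * norm (poly q t)"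
    using IH assms(3) by (intro mult_mono) auto
  moreover have "poly p t = (t - \<rho>) * poly q t"
    by (simp add: q algebra_simps)
  ultimately show ?case
    using lc by (simp add: deg norm_mult mult_ac)
qed

text \<open>A limit of zeros could only be lost at infinity. Writing r = u/w with (u, w) on the unit
  sphere compactifies the line, and at w = 0 the value is u^d F(V) \<noteq> 0, so the set is the
  projection of a compact set.\<close>

lemma closed_roots_escape:
  assumes F: "real_poly_fun F" and h: "homog d F" and V: "F V \<noteq> 0"
  shows "closed {\<tau>\<in>{0..1::real}. \<exists>r. F (\<lambda>k. a k + of_real \<tau> * b k + r * V k) = 0 \<and> Re (\<omega> * r) \<ge> 0}"
    (is "closed ?S")
proof -
  define f where "f = (\<lambda>x :: real \<times> complex \<times> complex.
    F (\<lambda>k. snd (snd x) * (a k + of_real (fst x) * b k) + fst (snd x) * V k))"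
  \<comment> \<open>The sign condition is Re (\<omega> u/w) \<ge> 0 multiplied by |w|^2, which makes
    sense and is closed at w = 0 as well.\<close>
  define C where "C = ({0..1} \<times> sphere 0 1) \<inter> ({x. f x = 0} \<inter>
    {x. 0 \<le> Re (\<omega> * fst (snd x) * cnj (snd (snd x)))})"
  have "continuous_on UNIV f"
    unfolding f_def by (intro real_poly_fun_continuous_on[OF F] continuous_intros)
  then have "closed ({x. f x = 0} \<inter> {x. 0 \<le> Re (\<omega> * fst (snd x) * cnj (snd (snd x)))})"
    by (intro closed_Int closed_Collect_eq closed_Collect_le continuous_intros)
  then have C: "compact C"
    unfolding C_def by (intro compact_Int_closed compact_Times) auto
  have "fst ` C = ?S"
  proof (intro equalityI subsetI)
    fix \<tau> assume "\<tau> \<in> fst ` C"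
    then obtain u w where \<tau>: "\<tau> \<in> {0..1}" and uw: "(u, w) \<in> sphere 0 1"
      and z: "f (\<tau>, u, w) = 0" and re: "0 \<le> Re (\<omega> * u * cnj w)"
      unfolding C_def by auto
    have w: "w \<noteq> 0"
    proof
      assume "w = 0"
      moreover from this have "u \<noteq> 0" using uw by (auto simp: norm_Pair)
      ultimately show False
        using z V homogD[OF h, of u V] by (simp add: f_def)
    qed
    have "f (\<tau>, u, w) = F (\<lambda>k. w * (a k + of_real \<tau> * b k + (u / w) * V k))"
      using w by (simp add: f_def algebra_simps)
    then have "F (\<lambda>k. a k + of_real \<tau> * b k + (u / w) * V k) = 0"
      using z w homogD[OF h w] by simp
    moreover have "Re (\<omega> * (u / w)) \<ge> 0"
    proof -
      have "\<omega> * (u / w) = \<omega> * u * cnj w / of_real ((cmod w)\<^sup>2)"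
        using complex_div_cnj[of "\<omega> * u" w] by simp
      then show ?thesis using re by (simp only: Re_divide_of_real) simp
    qed
    ultimately show "\<tau> \<in> ?S" using \<tau> by blast
  next
    fix \<tau> assume "\<tau> \<in> ?S"
    then obtain r where \<tau>: "\<tau> \<in> {0..1}" and r: "F (\<lambda>k. a k + of_real \<tau> * b k + r * V k) = 0"
      and re: "Re (\<omega> * r) \<ge> 0" by auto
    define n where "n = inverse (norm (r, 1 :: complex))"
    have "norm (r, 1 :: complex) > 0" by (simp add: norm_Pair add_nonneg_pos)
    then have n: "n > 0" "norm (n *\<^sub>R (r, 1 :: complex)) = 1"
      unfolding norm_scaleR by (auto simp: n_def)
    have "f (\<tau>, n *\<^sub>R r, n *\<^sub>R 1) = F (\<lambda>k. of_real n * (a k + of_real \<tau> * b k + r * V k))"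
      by (simp add: f_def scaleR_conv_of_real algebra_simps)
    also have "\<dots> = 0" using homogD[OF h, of "of_real n"] n r by simp
    finally have "(\<tau>, n *\<^sub>R (r, 1)) \<in> C"
      using \<tau> n re by (simp add: C_def)
    then show "\<tau> \<in> fst ` C" by force
  qed
  moreover have "compact (fst ` C)"
    using C by (intro compact_continuous_image continuous_intros)
  ultimately show ?thesis
    by (simp only: compact_imp_closed)
qed

text \<open>Connectedness of [0, 1] replaces continuity of roots. The parameters with a zero in the
  closed half-plane form a closed set \<open>S\<close>, those satisfying the lower bound a closed
  set \<open>T\<close>, and together they cover the interval. A common parameter would have a zero
  with Re (\<omega> r) > 0, where the bound forbids one. Since 0 is not in \<open>S\<close>, neither
  is 1.\<close>

lemma roots_half_plane_homotopy:
  assumes F: "real_poly_fun F" and h: "homog d F" and V: "F V \<noteq> 0" and \<omega>: "norm \<omega> = 1"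
    and start: "\<And>r. F (\<lambda>k. a k + r * V k) = 0 \<Longrightarrow> Re (\<omega> * r) < 0"
    and boundary: "\<And>\<tau> r. 0 \<le> \<tau> \<Longrightarrow> \<tau> \<le> 1 \<Longrightarrow>
      F (\<lambda>k. a k + of_real \<tau> * b k + r * V k) = 0 \<Longrightarrow> Re (\<omega> * r) \<noteq> 0"
    and r: "F (\<lambda>k. a k + b k + r * V k) = 0"
  shows "Re (\<omega> * r) < 0"
proof (rule ccontr)
  assume neg: "\<not> Re (\<omega> * r) < 0"
  let ?f = "\<lambda>\<tau> r. F (\<lambda>k. a k + of_real \<tau> * b k + r * V k)"
  define S where "S = {\<tau>\<in>{0..1::real}. \<exists>r. ?f \<tau> r = 0 \<and> Re (\<omega> * r) \<ge> 0}"
  define T where "T = {\<tau>. \<forall>r. Re (\<omega> * r) \<ge> 0 \<longrightarrow> norm (F V) * Re (\<omega> * r) ^ d \<le> norm (?f \<tau> r)}"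
  have "closed S"
    unfolding S_def by (rule closed_roots_escape[where F = F and V = V, OF F h V])
  have cont: "continuous_on UNIV (\<lambda>\<tau>. ?f \<tau> r)" for r
    by (intro real_poly_fun_continuous_on[OF F] continuous_intros)
  have "closed {\<tau>. norm (F V) * Re (\<omega> * r) ^ d \<le> norm (?f \<tau> r)}" for r
    by (rule closed_Collect_le[OF continuous_on_const continuous_on_norm[OF cont]])
  then have "closed (\<Inter>r\<in>{r. Re (\<omega> * r) \<ge> 0}.
      {\<tau>. norm (F V) * Re (\<omega> * r) ^ d \<le> norm (?f \<tau> r)})"
    by (intro closed_INT) blast
  moreover have "\<dots> = T"
    unfolding T_def by blast
  ultimately have "closed T" by simp
  have "\<tau> \<in> S \<or> \<tau> \<in> T" if \<tau>: "\<tau> \<in> {0..1}" for \<tau>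
  proof (cases "\<tau> \<in> S")
    case False
    obtain p where p: "degree p = d" "lead_coeff p = F V" "\<And>r. ?f \<tau> r = poly p r"
      using homog_line_poly[where F = F and V = V, OF F h V, of "\<lambda>k. a k + of_real \<tau> * b k"] by blast
    have "Re (\<omega> * \<rho>) \<le> 0" if "poly p \<rho> = 0" for \<rho>
      using that p(3) False \<tau> unfolding S_def by force
    then have "\<tau> \<in> T"
      using poly_half_plane_lower_bound[OF _ \<omega>, of p] p unfolding T_def by auto
    then show ?thesis ..
  qed simp
  then have "{0..1} \<subseteq> S \<union> T" by blast
  have "S \<inter> T \<inter> {0..1} = {}"
  proof -
    have False if \<tau>: "\<tau> \<in> S" "\<tau> \<in> T" for \<tau>
    proof -
      obtain r where r: "\<tau> \<in> {0..1}" "?f \<tau> r = 0" "Re (\<omega> * r) \<ge> 0"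
        using \<tau>(1) unfolding S_def by blast
      then have "Re (\<omega> * r) > 0" using boundary[of \<tau> r] by force
      then have "norm (F V) * Re (\<omega> * r) ^ d > 0" using V by simp
      then show False using \<tau>(2) r unfolding T_def by force
    qed
    then show ?thesis by auto
  qed
  have "1 \<in> S" using r neg unfolding S_def by force
  have "0 \<notin> S" using start unfolding S_def by force
  with \<open>{0..1} \<subseteq> S \<union> T\<close> have "0 \<in> T" by force
  moreover have "0 \<in> {0..1::real}" "1 \<in> {0..1::real}" by auto
  ultimately show False
    using connected_Icc[of 0 "1::real"] \<open>closed S\<close> \<open>closed T\<close> \<open>1 \<in> S\<close>
      \<open>{0..1} \<subseteq> S \<union> T\<close> \<open>S \<inter> T \<inter> {0..1} = {}\<close>
    unfolding connected_closed by blast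
qed

section \<open>Hyperbolicity directions and their cones\<close>

definition hyp_dir :: "(('i \<Rightarrow> complex) \<Rightarrow> complex) \<Rightarrow> ('i \<Rightarrow> real) \<Rightarrow> bool" where
  "hyp_dir F E \<longleftrightarrow> (\<forall>x z. Im z > 0 \<longrightarrow> F (\<lambda>k. of_real (x k) + z * of_real (E k)) \<noteq> 0)"

text \<open>The zeros of s \<mapsto> F(A + s E) are the negatives of the eigenvalues of A, so this
  is the set where all eigenvalues are nonnegative.\<close>

definition closed_cone :: "(('i \<Rightarrow> complex) \<Rightarrow> complex) \<Rightarrow> ('i \<Rightarrow> real) \<Rightarrow> ('i \<Rightarrow> real) set" where
  "closed_cone F E = {A. \<forall>s>0. F (\<lambda>k. of_real (A k + s * E k)) \<noteq> 0}"

lemma hyp_dir_nonreal: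
  assumes F: "real_poly_fun F" and E: "hyp_dir F E" and z: "Im z \<noteq> 0"
  shows "F (\<lambda>k. of_real (x k) + z * of_real (E k)) \<noteq> 0"
proof (cases "Im z > 0")
  case True
  then show ?thesis using E unfolding hyp_dir_def by blast
next
  case False
  then have "F (\<lambda>k. of_real (x k) + cnj z * of_real (E k)) \<noteq> 0"
    using E z unfolding hyp_dir_def by auto
  then show ?thesis
    using real_poly_fun_cnj[OF F, of "\<lambda>k. of_real (x k) + cnj z * of_real (E k)"] by simp
qed

lemma hyp_dir_nonzero:
  assumes "homog d F" "hyp_dir F E"
  shows "F (\<lambda>k. of_real (E k)) \<noteq> 0"
  using assms homogD[OF assms(1), of \<i> "\<lambda>k. of_real (E k)"]
  unfolding hyp_dir_def by (force dest: spec[of _ "\<lambda>_. 0"] spec[of _ \<i>])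

lemma homog_real_scale:
  assumes "homog d F" "u \<noteq> 0"
  shows "F (\<lambda>k. of_real (u * Y k)) = of_real u ^ d * F (\<lambda>k. of_real (Y k))"
  using homogD[OF assms(1), of "of_real u" "\<lambda>k. of_real (Y k)"] assms(2) by simp

lemma homog_real_zero_iff:
  assumes "homog d F" "u \<noteq> 0" "\<And>k. Z k = u * Y k"
  shows "F (\<lambda>k. of_real (Z k)) = 0 \<longleftrightarrow> F (\<lambda>k. of_real (Y k)) = 0"
  using homog_real_scale[OF assms(1,2), of Y] assms(2,3) by simp

text \<open>Along the segment the zeros of F in direction E stay real by hyperbolicity and avoid 0
  because F does not vanish on the segment, so they remain negative as they are at A. In other
  words, the open cone is a full connected component of the set F \<noteq> 0 in real space.\<close>

lemma hyp_dir_component: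
  assumes F: "real_poly_fun F" and h: "homog d F" and E: "hyp_dir F E"
    and A: "\<And>s. s \<ge> 0 \<Longrightarrow> F (\<lambda>k. of_real (A k + s * E k)) \<noteq> 0"
    and seg: "\<And>\<tau>. 0 \<le> \<tau> \<Longrightarrow> \<tau> \<le> 1 \<Longrightarrow> F (\<lambda>k. of_real (A k + \<tau> * (B k - A k))) \<noteq> 0"
    and s: "s \<ge> 0"
  shows "F (\<lambda>k. of_real (B k + s * E k)) \<noteq> 0"
proof
  assume 0: "F (\<lambda>k. of_real (B k + s * E k)) = 0"
  have "Re (1 * complex_of_real s) < 0"
  proof (rule roots_half_plane_homotopy[where F = F, OF F h hyp_dir_nonzero[OF h E]])
    fix r assume r: "F (\<lambda>k. of_real (A k) + r * of_real (E k)) = 0"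
    then have "Im r = 0" using hyp_dir_nonreal[OF F E] by blast
    then obtain u where u: "r = of_real u"
      by (metis Reals_cases complex_is_Real_iff)
    then have "F (\<lambda>k. of_real (A k + u * E k)) = 0" using r by simp
    then show "Re (1 * r) < 0" using A[of u] u by force
  next
    fix \<tau> :: real and r
    assume \<tau>: "0 \<le> \<tau>" "\<tau> \<le> 1"
      and "F (\<lambda>k. of_real (A k) + of_real \<tau> * of_real (B k - A k) + r * of_real (E k)) = 0"
    then have r: "F (\<lambda>k. of_real (A k + \<tau> * (B k - A k)) + r * of_real (E k)) = 0" by simp
    then have "Im r = 0"
      using hyp_dir_nonreal[OF F E, of r "\<lambda>k. A k + \<tau> * (B k - A k)"] by blast
    moreover have "r \<noteq> 0" using r seg[OF \<tau>] by auto
    ultimately show "Re (1 * r) \<noteq> 0" by (auto simp: complex_eq_iff)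
  next
    show "F (\<lambda>k. of_real (A k) + of_real (B k - A k) + of_real s * of_real (E k)) = 0"
      using 0 by simp
  qed simp
  then show False using s by simp
qed

text \<open>The perturbation \<i> \<alpha> E keeps the zeros r of F(x + \<i> \<alpha> E + r A) off
  the real axis for every real x, so it is enough to locate them for x = 0, where r = \<i> \<alpha>
  / \<sigma> with \<sigma> real and negative. The resulting lower bound does not depend on \<alpha>,
  and \<alpha> tends to 0.\<close>

lemma hyp_dir_change:
  assumes F: "real_poly_fun F" and h: "homog d F" and E: "hyp_dir F E"
    and A: "\<And>s. s \<ge> 0 \<Longrightarrow> F (\<lambda>k. of_real (A k + s * E k)) \<noteq> 0"
  shows "hyp_dir F A"
  unfolding hyp_dir_def
proof (intro allI impI)
  fix x :: "'a \<Rightarrow> real" and z assume z: "Im z > 0"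
  have FA: "F (\<lambda>k. of_real (A k)) \<noteq> 0" using A[of 0] by simp
  have FE: "F (\<lambda>k. of_real (E k)) \<noteq> 0" using hyp_dir_nonzero[OF h E] .
  have lower: "norm (F (\<lambda>k. of_real (A k))) * Im z ^ d
      \<le> norm (F (\<lambda>k. of_real (x k) + \<i> * of_real \<alpha> * of_real (E k) + z * of_real (A k)))"
    if \<alpha>: "\<alpha> > 0" for \<alpha> :: real
  proof -
    obtain p where p: "degree p = d" "lead_coeff p = F (\<lambda>k. of_real (A k))"
      "\<And>r. F (\<lambda>k. of_real (x k) + \<i> * of_real \<alpha> * of_real (E k) + r * of_real (A k)) = poly p r"
      using homog_line_poly[where F = F, OF F h FA, of "\<lambda>k. of_real (x k) + \<i> * of_real \<alpha> * of_real (E k)"]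
      by blast
    have "Re (-\<i> * \<rho>) \<le> 0" if "poly p \<rho> = 0" for \<rho>
    proof -
      \<comment> \<open>Here Re (-\<i> r) is Im r, and the homotopy moves from 0 to x.\<close>
      have "Re (-\<i> * \<rho>) < 0"
      proof (rule roots_half_plane_homotopy[where F = F, OF F h FA])
        fix r assume r: "F (\<lambda>k. \<i> * of_real \<alpha> * of_real (E k) + r * of_real (A k)) = 0"
        have "r \<noteq> 0"
        proof
          assume "r = 0"
          then show False using r FE \<alpha> homogD[OF h, of "\<i> * of_real \<alpha>" "\<lambda>k. of_real (E k)"] by simp
        qed
        define \<sigma> where "\<sigma> = \<i> * of_real \<alpha> / r"
        have "F (\<lambda>k. r * (of_real (A k) + \<sigma> * of_real (E k))) = 0"
          using r \<open>r \<noteq> 0\<close> by (simp add: \<sigma>_def algebra_simps)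
        then have \<sigma>: "F (\<lambda>k. of_real (A k) + \<sigma> * of_real (E k)) = 0"
          using homogD[OF h \<open>r \<noteq> 0\<close>] \<open>r \<noteq> 0\<close> by simp
        then have "Im \<sigma> = 0" using hyp_dir_nonreal[OF F E] by blast
        then obtain u where u: "\<sigma> = of_real u"
          by (metis Reals_cases complex_is_Real_iff)
        then have "F (\<lambda>k. of_real (A k + u * E k)) = 0" using \<sigma> by simp
        then have neg: "u < 0" using A[of u] by force
        have "\<sigma> * r = \<i> * of_real \<alpha>" using \<open>r \<noteq> 0\<close> by (simp add: \<sigma>_def)
        then have "Im (of_real u * r) = \<alpha>" using u by simp
        then have "u * Im r > 0" using \<alpha> by simp
        then show "Re (-\<i> * r) < 0" using neg by (simp add: zero_less_mult_iff)
      next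
        fix \<tau> :: real and r
        assume r: "F (\<lambda>k. \<i> * of_real \<alpha> * of_real (E k) + of_real \<tau> * of_real (x k) + r * of_real (A k)) = 0"
        have "Im r \<noteq> 0"
        proof
          assume "Im r = 0"
          then obtain u where u: "r = of_real u"
            by (metis Reals_cases complex_is_Real_iff)
          have "F (\<lambda>k. of_real (\<tau> * x k + u * A k) + \<i> * of_real \<alpha> * of_real (E k)) \<noteq> 0"
            using hyp_dir_nonreal[OF F E, of "\<i> * of_real \<alpha>" "\<lambda>k. \<tau> * x k + u * A k"] \<alpha> by simp
          then show False using r u by (simp add: algebra_simps)
        qed
        then show "Re (-\<i> * r) \<noteq> 0" by simp
      next
        show "F (\<lambda>k. \<i> * of_real \<alpha> * of_real (E k) + of_real (x k) + \<rho> * of_real (A k)) = 0"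
          using that p(3) by (simp add: add.commute)
      qed simp
      then show ?thesis by simp
    qed
    from poly_half_plane_lower_bound[where p = p and t = z and \<omega> = "-\<i>", OF this] show ?thesis
      using z p(2) by (simp add: p(1,3))
  qed
  let ?g = "\<lambda>\<alpha>. norm (F (\<lambda>k. of_real (x k) + \<i> * of_real \<alpha> * of_real (E k) + z * of_real (A k)))"
  have "continuous_on UNIV ?g"
    by (intro continuous_intros real_poly_fun_continuous_on[OF F])
  then have "(?g \<longlongrightarrow> ?g 0) (at_right 0)"
    unfolding continuous_on_def by (blast intro: tendsto_within_subset)
  moreover have "eventually (\<lambda>\<alpha>. norm (F (\<lambda>k. of_real (A k))) * Im z ^ d \<le> ?g \<alpha>) (at_right 0)"
    using lower by (auto intro: eventually_at_rightI[of 0 1])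
  ultimately have "norm (F (\<lambda>k. of_real (A k))) * Im z ^ d \<le> ?g 0"
    by (intro tendsto_lowerbound) auto
  moreover have "norm (F (\<lambda>k. of_real (A k))) * Im z ^ d > 0" using FA z by simp
  ultimately show "F (\<lambda>k. of_real (x k) + z * of_real (A k)) \<noteq> 0" by auto
qed

lemma closed_cone_shift:
  "A \<in> closed_cone F E \<Longrightarrow> \<eta> > 0 \<Longrightarrow> s \<ge> 0 \<Longrightarrow>
    F (\<lambda>k. of_real (A k + \<eta> * E k + s * E k)) \<noteq> 0"
  unfolding closed_cone_def by (auto simp: algebra_simps dest!: spec[of _ "\<eta> + s"])

lemma closed_cone_zero:
  assumes h: "homog d F" and E: "hyp_dir F E"
  shows "(\<lambda>k. 0) \<in> closed_cone F E"
  unfolding closed_cone_def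
proof (intro CollectI allI impI)
  fix s :: real assume "s > 0"
  then have "F (\<lambda>k. of_real (0 + s * E k)) = 0 \<longleftrightarrow> F (\<lambda>k. of_real (E k)) = 0"
    by (intro homog_real_zero_iff[OF h, of s]) auto
  then show "F (\<lambda>k. of_real (0 + s * E k)) \<noteq> 0"
    using hyp_dir_nonzero[OF h E] by blast
qed

lemma closed_cone_scale:
  assumes h: "homog d F" and E: "hyp_dir F E" and A: "A \<in> closed_cone F E" and u: "u \<ge> 0"
  shows "(\<lambda>k. u * A k) \<in> closed_cone F E"
proof (cases "u = 0")
  case False
  with u have "u > 0" by simp
  show ?thesis
    unfolding closed_cone_def
  proof (intro CollectI allI impI)
    fix s :: real assume s: "s > 0"
    have "F (\<lambda>k. of_real (u * A k + s * E k)) = 0 \<longleftrightarrow> F (\<lambda>k. of_real (A k + (s / u) * E k)) = 0"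
      by (rule homog_real_zero_iff[OF h, of u]) (use \<open>u > 0\<close> in \<open>auto simp: field_simps\<close>)
    moreover have "s / u > 0" using s \<open>u > 0\<close> by simp
    ultimately show "F (\<lambda>k. of_real (u * A k + s * E k)) \<noteq> 0"
      using A unfolding closed_cone_def by blast
  qed
qed (use closed_cone_zero[OF h E] in simp)

text \<open>Half of s E is given to each summand, which moves both into the open cone. Then A' = A +
  (s/2) E is itself a hyperbolicity direction, and the segment from E to B' = B + (s/2) E avoids the
  zeros of F, so B' also lies in the open cone of A' and B' + A' is not a zero.\<close>

lemma closed_cone_add:
  assumes F: "real_poly_fun F" and h: "homog d F" and E: "hyp_dir F E"
    and A: "A \<in> closed_cone F E" and B: "B \<in> closed_cone F E"
  shows "(\<lambda>k. A k + B k) \<in> closed_cone F E"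
  unfolding closed_cone_def
proof (intro CollectI allI impI)
  fix s :: real assume s: "s > 0"
  define A' B' where "A' = (\<lambda>k. A k + s / 2 * E k)" and "B' = (\<lambda>k. B k + s / 2 * E k)"
  have A': "F (\<lambda>k. of_real (A' k + u * E k)) \<noteq> 0" and B': "F (\<lambda>k. of_real (B' k + u * E k)) \<noteq> 0"
    if "u \<ge> 0" for u
    using closed_cone_shift[OF A, of "s / 2" u] closed_cone_shift[OF B, of "s / 2" u] that s
    by (auto simp: A'_def B'_def)
  have FE: "F (\<lambda>k. of_real (E k)) \<noteq> 0" using hyp_dir_nonzero[OF h E] .
  have "F (\<lambda>k. of_real (B' k + 1 * A' k)) \<noteq> 0"
  proof (rule hyp_dir_component[OF F h hyp_dir_change[OF F h E A']])
    fix u :: real assume u: "u \<ge> 0"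
    show "F (\<lambda>k. of_real (E k + u * A' k)) \<noteq> 0"
    proof (cases "u = 0")
      case False
      then have "F (\<lambda>k. of_real (E k + u * A' k)) = 0 \<longleftrightarrow> F (\<lambda>k. of_real (A' k + (1 / u) * E k)) = 0"
        by (intro homog_real_zero_iff[OF h, of u]) (auto simp: field_simps)
      moreover have "1 / u \<ge> 0" using u by simp
      ultimately show ?thesis using A' by blast
    qed (use FE in simp)
  next
    fix u :: real assume u: "0 \<le> u" "u \<le> 1"
    show "F (\<lambda>k. of_real (E k + u * (B' k - E k))) \<noteq> 0"
    proof (cases "u = 0")
      case False
      then have "F (\<lambda>k. of_real (E k + u * (B' k - E k))) = 0 \<longleftrightarrow>
          F (\<lambda>k. of_real (B' k + ((1 - u) / u) * E k)) = 0"
        by (intro homog_real_zero_iff[OF h, of u]) (auto simp: field_simps)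
      moreover have "(1 - u) / u \<ge> 0" using u by simp
      ultimately show ?thesis using B' by blast
    qed (use FE in simp)
  qed simp_all
  moreover have "B' k + 1 * A' k = A k + B k + s * E k" for k
    by (simp add: A'_def B'_def field_simps)
  ultimately show "F (\<lambda>k. of_real (A k + B k + s * E k)) \<noteq> 0" by (simp only:) simp
qed

lemma closed_cone_sum:
  assumes F: "real_poly_fun F" and h: "homog d F" and E: "hyp_dir F E"
  shows "(\<And>j. j \<in> J \<Longrightarrow> A j \<in> closed_cone F E) \<Longrightarrow> (\<lambda>k. \<Sum>j\<in>J. A j k) \<in> closed_cone F E"
proof (induction J rule: infinite_finite_induct)
  case (insert x J)
  then show ?case
    using closed_cone_add[OF F h E, of "A x" "\<lambda>k. \<Sum>j\<in>J. A j k"] by simp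
qed (use closed_cone_zero[OF h E] in simp_all)

text \<open>F is real and nonzero on the ray E + u A with u \<ge> 0, hence keeps its sign at E; A +
  s E is a positive multiple of a point of that ray. The inequalities for G need this sign, not only
  nonvanishing.\<close>

lemma closed_cone_pos:
  assumes F: "real_poly_fun F" and h: "homog d F" and E: "hyp_dir F E"
    and pos: "Re (F (\<lambda>k. of_real (E k))) > 0" and A: "A \<in> closed_cone F E" and s: "s > 0"
  shows "Re (F (\<lambda>k. of_real (A k + s * E k))) > 0"
proof -
  define g where "g = (\<lambda>u. Re (F (\<lambda>k. of_real (E k + u * A k))))"
  have ne: "g u \<noteq> 0" if "u \<ge> 0" for u
  proof (cases "u = 0")
    case False
    then have "F (\<lambda>k. of_real (E k + u * A k)) = 0 \<longleftrightarrow> F (\<lambda>k. of_real (A k + (1 / u) * E k)) = 0"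
      by (intro homog_real_zero_iff[OF h, of u]) (auto simp: field_simps)
    moreover have "1 / u > 0" using that False by simp
    ultimately have "F (\<lambda>k. of_real (E k + u * A k)) \<noteq> 0"
      using A unfolding closed_cone_def by blast
    then show ?thesis
      using real_poly_fun_of_real[OF F, of "\<lambda>k. E k + u * A k"] by (auto simp: g_def)
  qed (use pos in \<open>simp add: g_def\<close>)
  have "continuous_on {0..1 / s} g"
    unfolding g_def by (intro continuous_intros real_poly_fun_continuous_on[OF F])
  moreover have "g 0 > 0" using pos by (simp add: g_def)
  ultimately have g: "g (1 / s) > 0"
    using IVT2'[of g "1 / s" 0 0] ne s by (smt (verit) divide_pos_pos)
  have "F (\<lambda>k. of_real (A k + s * E k)) = F (\<lambda>k. of_real (s * (E k + (1 / s) * A k)))"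
    using s by (intro arg_cong[where f = F]) (auto simp: field_simps)
  also have "\<dots> = of_real (s ^ d) * F (\<lambda>k. of_real (E k + (1 / s) * A k))"
    unfolding of_real_power by (rule homog_real_scale[OF h]) (use s in simp)
  finally have "Re (F (\<lambda>k. of_real (A k + s * E k))) = s ^ d * g (1 / s)"
    unfolding g_def by (simp only: Re_complex_of_real times_complex.sel Im_complex_of_real mult_zero_left diff_zero)
  then show ?thesis using g s by simp
qed

lemma closed_cone_nonneg:
  assumes F: "real_poly_fun F" and h: "homog d F" and E: "hyp_dir F E"
    and pos: "Re (F (\<lambda>k. of_real (E k))) > 0" and A: "A \<in> closed_cone F E"
  shows "Re (F (\<lambda>k. of_real (A k))) \<ge> 0"
proof -
  let ?g = "\<lambda>s. Re (F (\<lambda>k. of_real (A k + s * E k)))"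
  have "continuous_on UNIV ?g"
    by (intro continuous_intros real_poly_fun_continuous_on[OF F])
  then have "(?g \<longlongrightarrow> ?g 0) (at_right 0)"
    unfolding continuous_on_def by (blast intro: tendsto_within_subset)
  moreover have "eventually (\<lambda>s. 0 \<le> ?g s) (at_right 0)"
    using closed_cone_pos[OF F h E pos A] by (auto intro!: eventually_at_rightI[of 0 1] less_imp_le)
  ultimately show ?thesis
    using tendsto_lowerbound[of ?g "?g 0" "at_right 0" 0] by auto
qed

section \<open>Partial derivatives and half-plane stability\<close>

definition pd :: "'i \<Rightarrow> (('i \<Rightarrow> complex) \<Rightarrow> complex) \<Rightarrow> ('i \<Rightarrow> complex) \<Rightarrow> complex" where
  "pd j F X = deriv (\<lambda>s. F (X(j := s))) (X j)"

text \<open>The existential form lets the induction show at the same time that the derivative is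
  again a polynomial; \<open>pd\<close> is identified with it afterwards.\<close>

lemma real_poly_fun_partial_derivative:
  assumes "real_poly_fun F"
  shows "\<exists>F'. real_poly_fun F' \<and> (\<forall>X. ((\<lambda>s. F (X(j := s))) has_field_derivative F' X) (at (X j)))"
  using assms
proof induction
  case (const c)
  show ?case
    by (rule exI[of _ "\<lambda>X. 0"]) (use real_poly_fun.const[of 0] in simp)
next
  case (coord k)
  show ?case
  proof (cases "k = j")
    case True
    then show ?thesis
      by (intro exI[of _ "\<lambda>X. 1"]) (use real_poly_fun.const[of 1] in simp)
  next
    case False
    then show ?thesis
      by (intro exI[of _ "\<lambda>X. 0"]) (use real_poly_fun.const[of 0] in simp)
  qed
next
  case (add F G)
  then obtain F' G' where
    "real_poly_fun F'" "\<And>X. ((\<lambda>s. F (X(j := s))) has_field_derivative F' X) (at (X j))"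
    "real_poly_fun G'" "\<And>X. ((\<lambda>s. G (X(j := s))) has_field_derivative G' X) (at (X j))"
    by blast
  then show ?case
    by (intro exI[of _ "\<lambda>X. F' X + G' X"] conjI allI real_poly_fun.add DERIV_add)
next
  case (mult F G)
  then obtain F' G' where
    FG: "real_poly_fun F'" "\<And>X. ((\<lambda>s. F (X(j := s))) has_field_derivative F' X) (at (X j))"
    "real_poly_fun G'" "\<And>X. ((\<lambda>s. G (X(j := s))) has_field_derivative G' X) (at (X j))"
    by blast
  have "((\<lambda>s. F (X(j := s)) * G (X(j := s))) has_field_derivative F' X * G X + G' X * F X) (at (X j))" for X
    using DERIV_mult[OF FG(2)[of X] FG(4)[of X]] by simp
  moreover have "real_poly_fun (\<lambda>X. F' X * G X + G' X * F X)"
    by (intro real_poly_fun.intros mult FG)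
  ultimately show ?case by blast
qed

lemma pd_eqI:
  "(\<And>X. ((\<lambda>s. F (X(j := s))) has_field_derivative F' X) (at (X j))) \<Longrightarrow> pd j F = F'"
  unfolding pd_def by (auto intro: DERIV_imp_deriv)

lemma real_poly_fun_pd: "real_poly_fun F \<Longrightarrow> real_poly_fun (pd j F)"
  using real_poly_fun_partial_derivative[of F j] pd_eqI[of F j] by blast

lemma has_field_derivative_pd:
  "real_poly_fun F \<Longrightarrow> ((\<lambda>s. F (X(j := s))) has_field_derivative pd j F X) (at (X j))"
  using real_poly_fun_partial_derivative[of F j] pd_eqI[of F j] by blast

lemma pd_cong: "(\<And>s. F (X(j := s)) = G (Y(j := s))) \<Longrightarrow> X j = Y j \<Longrightarrow> pd j F X = pd j G Y"
  unfolding pd_def by simp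

lemma pd_const: "pd j (\<lambda>X. c) = (\<lambda>X. 0)"
  by (rule pd_eqI) simp

lemma pd_coord: "pd j (\<lambda>X. X k) = (\<lambda>X. if k = j then 1 else 0)"
  by (rule pd_eqI) auto

lemma pd_add:
  assumes "real_poly_fun F" "real_poly_fun G"
  shows "pd j (\<lambda>X. F X + G X) = (\<lambda>X. pd j F X + pd j G X)"
  by (rule pd_eqI) (intro DERIV_add has_field_derivative_pd assms)

lemma pd_diff:
  assumes "real_poly_fun F" "real_poly_fun G"
  shows "pd j (\<lambda>X. F X - G X) = (\<lambda>X. pd j F X - pd j G X)"
  by (rule pd_eqI) (intro DERIV_diff has_field_derivative_pd assms)

lemma pd_mult:
  assumes "real_poly_fun F" "real_poly_fun G"
  shows "pd j (\<lambda>X. F X * G X) = (\<lambda>X. pd j F X * G X + pd j G X * F X)"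
proof (rule pd_eqI)
  fix X
  show "((\<lambda>s. F (X(j := s)) * G (X(j := s))) has_field_derivative pd j F X * G X + pd j G X * F X) (at (X j))"
    using DERIV_mult[OF has_field_derivative_pd[OF assms(1), of X j] has_field_derivative_pd[OF assms(2), of X j]]
    by simp
qed

lemma pd_commute:
  assumes "real_poly_fun F"
  shows "pd i (pd j F) = pd j (pd i F)"
  using assms
proof induction
  case (add F G)
  then show ?case by (simp add: pd_add real_poly_fun_pd)
next
  case (mult F G)
  then show ?case
    by (simp add: pd_mult pd_add real_poly_fun_pd real_poly_fun.mult) (simp add: algebra_simps)
qed (simp_all add: pd_const pd_coord if_distrib[of "\<lambda>c X. c"])

text \<open>This is homogeneity of degree d - 1, with an extra factor r on the left to avoid
  truncated subtraction at d = 0.\<close>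

lemma pd_homog:
  assumes F: "real_poly_fun F" and h: "homog d F" and r: "r \<noteq> 0"
  shows "r * pd j F (\<lambda>k. r * X k) = r ^ d * pd j F X"
proof -
  have upd: "(\<lambda>k. r * X k)(j := r * s) = (\<lambda>k. r * (X(j := s)) k)" for s
    by auto
  have "((\<lambda>s. F ((\<lambda>k. r * X k)(j := s))) has_field_derivative pd j F (\<lambda>k. r * X k)) (at (r * X j))"
    using has_field_derivative_pd[OF F, of "\<lambda>k. r * X k" j] by simp
  moreover have "((\<lambda>s. r * s) has_field_derivative r) (at (X j))"
    by (auto intro!: derivative_eq_intros)
  ultimately have "((\<lambda>s. F ((\<lambda>k. r * X k)(j := r * s))) has_field_derivative
      pd j F (\<lambda>k. r * X k) * r) (at (X j))"
    by (rule DERIV_chain2)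
  then have "((\<lambda>s. r ^ d * F (X(j := s))) has_field_derivative pd j F (\<lambda>k. r * X k) * r) (at (X j))"
    unfolding upd homogD[OF h r] .
  moreover have "((\<lambda>s. r ^ d * F (X(j := s))) has_field_derivative r ^ d * pd j F X) (at (X j))"
    by (intro DERIV_cmult has_field_derivative_pd F)
  ultimately show ?thesis
    using DERIV_unique by (force simp: mult.commute)
qed

lemma has_real_derivative_pd:
  assumes "real_poly_fun F"
  shows "((\<lambda>\<sigma>. Re (F (\<lambda>k. of_real ((Z(j := \<sigma>)) k)))) has_real_derivative
    Re (pd j F (\<lambda>k. of_real (Z k)))) (at (Z j))"
proof -
  have eq: "(\<lambda>k. complex_of_real (Z k))(j := of_real \<sigma>) = (\<lambda>k. of_real ((Z(j := \<sigma>)) k))" for \<sigma>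
    by auto
  have "((\<lambda>\<sigma>. F ((\<lambda>k. of_real (Z k))(j := of_real \<sigma>))) has_vector_derivative
      pd j F (\<lambda>k. of_real (Z k))) (at (Z j))"
    using has_field_derivative_pd[OF assms, of "\<lambda>k. of_real (Z k)" j]
    by (rule has_vector_derivative_real_field)
  then have "((\<lambda>\<sigma>. Re (F (\<lambda>k. of_real ((Z(j := \<sigma>)) k)))) has_vector_derivative
    Re (pd j F (\<lambda>k. of_real (Z k)))) (at (Z j))"
    unfolding eq by (rule bounded_linear.has_vector_derivative[OF bounded_linear_Re])
  then show ?thesis
    by (simp add: has_real_derivative_iff_has_vector_derivative)
qed

text \<open>The logarithmic derivative is the sum of 1/(w - \<rho>) over the zeros, and Im \<rho>
  \<le> 0 < Im w gives every term a negative imaginary part. The alternative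
  \<open>pderiv p = 0\<close> is the empty sum.\<close>

lemma pderiv_quotient_lower_half_plane:
  fixes p :: "complex poly"
  assumes "\<And>s. Im s > 0 \<Longrightarrow> poly p s \<noteq> 0" "Im w > 0"
  shows "pderiv p = 0 \<or> Im (poly (pderiv p) w / poly p w) < 0"
  using assms(1)
proof (induction "degree p" arbitrary: p)
  case 0
  then show ?case by (simp add: pderiv_eq_0_iff)
next
  case (Suc n)
  have "\<not> constant (poly p)"
    using Suc.hyps(2) by (simp add: constant_degree)
  then obtain \<rho> where \<rho>: "poly p \<rho> = 0"
    using fundamental_theorem_of_algebra by blast
  then obtain q where q: "p = [:-\<rho>, 1:] * q"
    by (metis dvdE poly_eq_0_iff_dvd)
  have "q \<noteq> 0" using Suc.hyps(2) q by auto
  then have deg: "degree p = Suc (degree q)"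
    unfolding q by (subst degree_mult_eq) auto
  have nz: "poly q s \<noteq> 0" if "Im s > 0" for s
    using Suc.prems[OF that] by (simp add: q)
  then have IH: "pderiv q = 0 \<or> Im (poly (pderiv q) w / poly q w) < 0"
    using Suc.hyps deg by auto
  have Im: "Im (w - \<rho>) > 0" using Suc.prems \<rho> assms(2) by (smt (verit) minus_complex.sel(2))
  then have "w - \<rho> \<noteq> 0" by auto
  have "pderiv p = q + [:-\<rho>, 1:] * pderiv q"
    unfolding q by (subst pderiv_mult) (simp add: pderiv_pCons)
  then have "poly (pderiv p) w = poly q w + (w - \<rho>) * poly (pderiv q) w"
    by (simp only: poly_add poly_mult) (simp add: algebra_simps)
  moreover have "poly p w = (w - \<rho>) * poly q w"
    by (simp add: q algebra_simps)
  ultimately have "poly (pderiv p) w / poly p w = 1 / (w - \<rho>) + poly (pderiv q) w / poly q w"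
    using nz[OF assms(2)] \<open>w - \<rho> \<noteq> 0\<close> by (simp add: add_divide_distrib)
  moreover have "Im (1 / (w - \<rho>)) < 0"
    using Im \<open>w - \<rho> \<noteq> 0\<close> by (simp add: Im_divide divide_neg_pos sum_power2_gt_zero_iff complex_eq_iff)
  ultimately show ?case using IH by auto
qed

text \<open>A zero would make the logarithmic derivative equal to 1/y, whose imaginary part is
  nonnegative when Im y \<le> 0.\<close>

lemma poly_minus_pderiv_nonzero:
  fixes p :: "complex poly"
  assumes "\<And>s. Im s > 0 \<Longrightarrow> poly p s \<noteq> 0" "Im w > 0" "Im y \<le> 0"
  shows "poly p w - y * poly (pderiv p) w \<noteq> 0"
proof
  assume "poly p w - y * poly (pderiv p) w = 0"
  then have eq: "poly p w = y * poly (pderiv p) w" by simp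
  then have nz: "y \<noteq> 0" "poly (pderiv p) w \<noteq> 0" using assms(1)[OF assms(2)] by auto
  then have "Im (poly (pderiv p) w / poly p w) = Im (1 / y)" by (simp add: eq)
  moreover have "Im (1 / y) \<ge> 0" using assms(3) by (simp add: Im_divide divide_nonpos_nonneg)
  moreover have "pderiv p \<noteq> 0" using nz by auto
  ultimately show False
    using pderiv_quotient_lower_half_plane[OF assms(1,2)] by simp
qed

section \<open>The operators 1 - y D and the barrier argument\<close>

text \<open>\<open>Inl j\<close> indexes the variable z_j and \<open>Inr j\<close> the variable y_j.\<close>

type_synonym coord = "nat + nat"

definition mop :: "nat \<Rightarrow> ((coord \<Rightarrow> complex) \<Rightarrow> complex) \<Rightarrow> (coord \<Rightarrow> complex) \<Rightarrow> complex" where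
  "mop j F X = F X - X (Inr j) * pd (Inl j) F X"

lemma real_poly_fun_mop: "real_poly_fun F \<Longrightarrow> real_poly_fun (mop j F)"
  unfolding mop_def by (intro real_poly_fun_diff real_poly_fun.intros real_poly_fun_pd)

lemma mop_commute:
  assumes "real_poly_fun F"
  shows "mop i (mop j F) = mop j (mop i F)"
proof -
  have "pd (Inl i) (mop j F) = (\<lambda>X. pd (Inl i) F X - X (Inr j) * pd (Inl i) (pd (Inl j) F) X)" for i j
    unfolding mop_def
    by (simp add: assms pd_diff pd_mult pd_coord real_poly_fun.intros real_poly_fun_pd mult.commute)
  then show ?thesis
    by (auto simp: mop_def[of _ "mop _ F"] mop_def[of _ F] pd_commute[OF assms, of "Inl i" "Inl j"]
        algebra_simps)
qed

lemma mop_homog: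
  assumes "real_poly_fun F" "homog d F"
  shows "homog d (mop j F)"
  unfolding homog_def
proof (intro allI impI)
  fix r X assume "(r :: complex) \<noteq> 0"
  then show "mop j F (\<lambda>k. r * X k) = r ^ d * mop j F X"
    using pd_homog[OF assms, of r "Inl j" X] homogD[OF assms(2), of r X]
    by (simp add: mop_def algebra_simps)
qed

text \<open>The y-region includes the real axis, so that moving in direction (1, 0) from a real
  point, which leaves y real, stays inside the zero-free region.\<close>

definition half_plane_stable :: "nat \<Rightarrow> ((coord \<Rightarrow> complex) \<Rightarrow> complex) \<Rightarrow> bool" where
  "half_plane_stable m F \<longleftrightarrow> (\<forall>X. (\<forall>j<m. Im (X (Inl j)) > 0) \<and> (\<forall>j<m. Im (X (Inr j)) \<le> 0) \<longrightarrow> F X \<noteq> 0)"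

text \<open>With every coordinate except z_j frozen, this is the one-variable statement about p - y
  p'.\<close>

lemma mop_stable:
  assumes F: "real_poly_fun F" and st: "half_plane_stable m F" and j: "j < m"
  shows "half_plane_stable m (mop j F)"
  unfolding half_plane_stable_def
proof (intro allI impI, elim conjE)
  fix X :: "coord \<Rightarrow> complex"
  assume X: "\<forall>j<m. Im (X (Inl j)) > 0" "\<forall>j<m. Im (X (Inr j)) \<le> 0"
  obtain p where "\<And>r. F (\<lambda>k. (X(Inl j := 0)) k + r * (if k = Inl j then 1 else 0)) = poly p r"
    using real_poly_fun_line[OF F] by metis
  moreover have "(\<lambda>k. (X(Inl j := 0)) k + r * (if k = Inl j then 1 else 0)) = X(Inl j := r)" for r
    by auto
  ultimately have p: "F (X(Inl j := r)) = poly p r" for r by metis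
  have "poly p s \<noteq> 0" if "Im s > 0" for s
    using st[unfolded half_plane_stable_def, THEN spec, of "X(Inl j := s)"] X that
    by (simp add: p)
  then have "poly p (X (Inl j)) - X (Inr j) * poly (pderiv p) (X (Inl j)) \<noteq> 0"
    using X j by (intro poly_minus_pderiv_nonzero) auto
  moreover have "pd (Inl j) F X = poly (pderiv p) (X (Inl j))"
    unfolding pd_def p by (intro DERIV_imp_deriv poly_DERIV)
  ultimately show "mop j F X \<noteq> 0"
    using p[of "X (Inl j)"] by (simp add: mop_def)
qed

lemma real_poly_fun_mops: "real_poly_fun F \<Longrightarrow> real_poly_fun (foldr mop xs F)"
  by (induction xs) (auto intro: real_poly_fun_mop)

lemma mops_homog: "real_poly_fun F \<Longrightarrow> homog d F \<Longrightarrow> homog d (foldr mop xs F)"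
  by (induction xs) (auto intro: mop_homog real_poly_fun_mops)

lemma mops_stable: "real_poly_fun F \<Longrightarrow> half_plane_stable m F \<Longrightarrow> set xs \<subseteq> {..<m} \<Longrightarrow> half_plane_stable m (foldr mop xs F)"
  by (induction xs) (auto intro: mop_stable real_poly_fun_mops)

lemma mops_zero: "(\<And>l. l \<in> set xs \<Longrightarrow> X (Inr l) = 0) \<Longrightarrow> foldr mop xs F X = F X"
  by (induction xs) (auto simp: mop_def)

lemma mops_cong:
  assumes "\<And>X Y. (\<And>l. X (Inl l) = Y (Inl l)) \<Longrightarrow> F X = F Y"
  shows "(\<And>l. X (Inl l) = Y (Inl l)) \<Longrightarrow> (\<And>l. l \<in> set xs \<Longrightarrow> X (Inr l) = Y (Inr l)) \<Longrightarrow>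
    foldr mop xs F X = foldr mop xs F Y"
proof (induction xs arbitrary: X Y)
  case Nil
  then show ?case using assms[of X Y] by simp
next
  case (Cons a xs)
  have "foldr mop xs F (X(Inl a := s)) = foldr mop xs F (Y(Inl a := s))" for s
    using Cons.prems by (intro Cons.IH) auto
  then have "pd (Inl a) (foldr mop xs F) X = pd (Inl a) (foldr mop xs F) Y"
    using Cons.prems by (intro pd_cong)
  moreover have "foldr mop xs F X = foldr mop xs F Y"
    using Cons.prems by (intro Cons.IH) auto
  ultimately show ?case using Cons.prems by (simp add: mop_def[of a])
qed

lemma mops_move_front:
  assumes "real_poly_fun F"
  shows "foldr mop (xs @ i # ys) F = mop i (foldr mop (xs @ ys) F)"
  by (induction xs) (simp_all add: mop_commute real_poly_fun_mops assms)

text \<open>A, A', B, B' stand for the values of R, \<partial>_i R, \<partial>_j R, \<partial>_i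
  \<partial>_j R at one point, so the conclusion is positivity of (1 - \<partial>_i)(1 - \<mu>
  \<partial>_j) R. With f = A/B and f' its derivative in z_i, the hypothesis \<open>B1\<close> reads
  \<nu> f' \<le> f - \<mu>.\<close>

lemma barrier_inequality:
  fixes A A' B B' \<mu> \<nu> :: real
  assumes \<mu>: "\<mu> > 1" and \<nu>: "\<nu> = \<mu> / (\<mu> - 1)" and A: "A - \<mu> * A' \<ge> 0" "A - \<mu> * B > 0" "B \<ge> 0"
    and B0: "B = 0 \<Longrightarrow> B' \<ge> 0"
    and B1: "B > 0 \<Longrightarrow> \<nu> * (A' * B - A * B') \<le> (A - \<mu> * B) * B"
  shows "A - A' - \<mu> * B + \<mu> * B' > 0"
proof -
  have \<nu>0: "\<nu> > 0" using \<mu> \<nu> by simp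
  have inv: "1 / \<nu> = 1 - 1 / \<mu>" using \<mu> by (simp add: \<nu> field_simps)
  have A0: "A > 0" using A \<mu> by (smt (verit) mult_nonneg_nonneg)
  have A': "A' \<le> A / \<mu>" using A(1) \<mu> by (simp add: field_simps)
  show ?thesis
  proof (cases "B = 0")
    case True
    have "A - A / \<mu> > 0" using A0 \<mu> by (simp add: field_simps)
    moreover have "\<mu> * B' \<ge> 0" using B0[OF True] \<mu> by simp
    ultimately show ?thesis using A' True by simp
  next
    case False
    then have "B > 0" using A by simp
    from B1[OF this] have tangent: "A * B' \<ge> A' * B - (A - \<mu> * B) * B / \<nu>"
      using \<nu>0 by (simp add: field_simps)
    \<comment> \<open>This is where 1/\<mu> + 1/\<nu> = 1 enters: A - A' is at least A (1 - 1/\<mu>)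
      = A/\<nu>.\<close>
    have "A - A' - \<mu> * B / \<nu> \<ge> (A - \<mu> * B) / \<nu>"
    proof -
      have "(A - \<mu> * B) / \<nu> = A * (1 / \<nu>) - \<mu> * B / \<nu>" by (simp add: diff_divide_distrib)
      also have "\<dots> = A - A / \<mu> - \<mu> * B / \<nu>" by (simp only: inv) (simp add: algebra_simps)
      finally show ?thesis using A' by simp
    qed
    moreover have "(A - \<mu> * B) / \<nu> > 0" using A(2) \<nu>0 by simp
    ultimately have "A - A' - \<mu> * B / \<nu> > 0" by (rule less_le_trans[rotated])
    with A(2) have pos: "(A - \<mu> * B) * (A - A' - \<mu> * B / \<nu>) > 0"
      by (rule mult_pos_pos)
    \<comment> \<open>Eliminating B' by the tangent inequality bounds A times the goal from below by
      this product of two positive factors.\<close>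
    have "(A - \<mu> * B) * (A - A' - \<mu> * B / \<nu>)
        = A * (A - A' - \<mu> * B) + \<mu> * (A' * B - (A - \<mu> * B) * B / \<nu>)"
      by (simp add: algebra_simps)
    also have "\<dots> \<le> A * (A - A' - \<mu> * B) + \<mu> * (A * B')"
      using tangent \<mu> by simp
    also have "\<dots> = A * (A - A' - \<mu> * B + \<mu> * B')" by (simp add: algebra_simps)
    finally have "A * (A - A' - \<mu> * B + \<mu> * B') > 0" using pos by simp
    then show ?thesis using A0 by (simp add: zero_less_mult_iff)
  qed
qed

section \<open>The convex cone Q of the polynomial G\<close>

definition one_zero :: "coord \<Rightarrow> real" where
  "one_zero = case_sum (\<lambda>_. 1) (\<lambda>_. 0)"

text \<open>An abstract form of h restricted to the span of the vectors. The normalization makes G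
  equal to 1 at (1, 0), which fixes its sign on Q.\<close>

locale stable_poly =
  fixes m d :: nat and H :: "(coord \<Rightarrow> complex) \<Rightarrow> complex"
  assumes poly_H: "real_poly_fun H" and homog_H: "homog d H" and stable_H: "half_plane_stable m H"
    and cong_H: "\<And>X Y. (\<And>l. X (Inl l) = Y (Inl l)) \<Longrightarrow> H X = H Y"
    and norm_H: "H (\<lambda>k. of_real (one_zero k)) = 1"
begin

definition G :: "(coord \<Rightarrow> complex) \<Rightarrow> complex" where
  "G = foldr mop [0..<m] H"

abbreviation Q :: "(coord \<Rightarrow> real) set" where
  "Q \<equiv> closed_cone G one_zero"

lemma poly_G: "real_poly_fun G"
  unfolding G_def by (rule real_poly_fun_mops[OF poly_H])

lemma homog_G: "homog d G"
  unfolding G_def by (rule mops_homog[OF poly_H homog_H])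

lemma stable_G: "half_plane_stable m G"
  unfolding G_def by (rule mops_stable[OF poly_H stable_H]) auto

lemma hyp_dir_G: "hyp_dir G one_zero"
  using stable_G unfolding hyp_dir_def half_plane_stable_def by (auto simp: one_zero_def)

lemma G_one: "G (\<lambda>k. of_real (one_zero k)) = 1"
  unfolding G_def norm_H[symmetric] by (rule mops_zero) (simp add: one_zero_def)

text \<open>Multiplication by \<i> carries the perturbed point into the zero-free region. Through
  \<open>Q_add\<close> this makes Q monotone: z may be increased and y decreased.\<close>

lemma Q_orthant:
  assumes "\<And>l. l < m \<Longrightarrow> Y (Inl l) \<ge> 0" "\<And>l. l < m \<Longrightarrow> Y (Inr l) \<le> 0"
  shows "Y \<in> Q"
  unfolding closed_cone_def
proof (intro CollectI allI impI)
  fix s :: real assume "s > 0"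
  then have "G (\<lambda>k. \<i> * of_real (Y k + s * one_zero k)) \<noteq> 0"
    using assms stable_G[unfolded half_plane_stable_def, THEN spec,
        of "\<lambda>k. \<i> * of_real (Y k + s * one_zero k)"]
    by (simp add: one_zero_def add_nonneg_pos)
  then show "G (\<lambda>k. of_real (Y k + s * one_zero k)) \<noteq> 0"
    using homogD[OF homog_G, of \<i> "\<lambda>k. of_real (Y k + s * one_zero k)"] by auto
qed

lemma Q_add: "A \<in> Q \<Longrightarrow> B \<in> Q \<Longrightarrow> (\<lambda>k. A k + B k) \<in> Q"
  by (rule closed_cone_add[where F = G, OF poly_G homog_G hyp_dir_G])

lemma Q_scale: "A \<in> Q \<Longrightarrow> u \<ge> 0 \<Longrightarrow> (\<lambda>k. u * A k) \<in> Q"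
  by (rule closed_cone_scale[where F = G, OF homog_G hyp_dir_G])

lemma Q_sum: "(\<And>j. j \<in> J \<Longrightarrow> A j \<in> Q) \<Longrightarrow> (\<lambda>k. \<Sum>j\<in>J. A j k) \<in> Q"
  by (rule closed_cone_sum[where F = G, OF poly_G homog_G hyp_dir_G])

lemma Q_pos: "A \<in> Q \<Longrightarrow> s > 0 \<Longrightarrow> Re (G (\<lambda>k. of_real (A k + s * one_zero k))) > 0"
  by (rule closed_cone_pos[where F = G, OF poly_G homog_G hyp_dir_G]) (simp_all add: G_one)

lemma Q_nonneg: "A \<in> Q \<Longrightarrow> Re (G (\<lambda>k. of_real (A k))) \<ge> 0"
  by (rule closed_cone_nonneg[where F = G, OF poly_G homog_G hyp_dir_G]) (simp_all add: G_one)

lemma G_move_front: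
  assumes "i < m"
  obtains xs where "G = mop i (foldr mop xs H)" "i \<notin> set xs" "set xs = {..<m} - {i}" "distinct xs"
proof -
  obtain xs ys where xy: "[0..<m] = xs @ i # ys"
    using assms split_list[of i "[0..<m]"] by auto
  then have "distinct (xs @ i # ys)" "set (xs @ i # ys) = {..<m}"
    by (metis distinct_upt, metis set_upt lessThan_atLeast0)
  then show thesis
    using that[of "xs @ ys"] mops_move_front[OF poly_H, of xs i ys] by (auto simp: G_def xy)
qed

text \<open>Moving both operators to the front leaves (1 - y_i \<partial>_i)(1 - y_j \<partial>_j) R
  with R free of y_i and y_j. The four functions are R, \<partial>_i R, \<partial>_j R and
  \<partial>_i \<partial>_j R on real points.\<close>

lemma G_bilinear:
  assumes i: "i < m" and j: "j < m" and ij: "i \<noteq> j"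
  obtains r ri rj rij :: "(coord \<Rightarrow> real) \<Rightarrow> real" where
    "\<And>Z. Re (G (\<lambda>k. of_real (Z k))) =
      r Z - Z (Inr i) * ri Z - Z (Inr j) * rj Z + Z (Inr i) * Z (Inr j) * rij Z"
    "\<And>f Z u w. f \<in> {r, ri, rj, rij} \<Longrightarrow> f (Z(Inr i := u, Inr j := w)) = f Z"
    "\<And>Z. ((\<lambda>\<sigma>. r (Z(Inl i := \<sigma>))) has_real_derivative ri Z) (at (Z (Inl i)))"
    "\<And>Z. ((\<lambda>\<sigma>. rj (Z(Inl i := \<sigma>))) has_real_derivative rij Z) (at (Z (Inl i)))"
proof -
  obtain zs where zs: "G = mop i (foldr mop zs H)" "set zs = {..<m} - {i}" "distinct zs"
    using G_move_front[OF i] by metis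
  then obtain xs ys where xy: "zs = xs @ j # ys"
    using j ij split_list[of j zs] by auto
  define R where "R = foldr mop (xs @ ys) H"
  have GR: "G = mop i (mop j R)"
    using mops_move_front[OF poly_H, of xs j ys] by (simp add: zs(1) xy R_def)
  have notin: "i \<notin> set (xs @ ys)" "j \<notin> set (xs @ ys)"
    using zs(2,3) xy by auto
  have R: "real_poly_fun R"
    unfolding R_def by (rule real_poly_fun_mops[OF poly_H])
  have cong: "R (X(Inr i := u, Inr j := w)) = R X" for X u w
    unfolding R_def by (rule mops_cong[where F = H, OF cong_H]) (use notin in auto)
  have cong': "pd (Inl l) F (X(Inr i := u, Inr j := w)) = pd (Inl l) F X"
    if "\<And>X u w. F (X(Inr i := u, Inr j := w)) = F X" for F l and X :: "coord \<Rightarrow> complex" and u w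
  proof (rule pd_cong)
    fix s
    have "X(Inr i := u, Inr j := w, Inl l := s) = X(Inl l := s, Inr i := u, Inr j := w)"
      by auto
    then show "F (X(Inr i := u, Inr j := w, Inl l := s)) = F (X(Inl l := s))"
      using that by simp
  qed simp
  let ?v = "\<lambda>F Z. Re (F (\<lambda>k. complex_of_real (Z k)))"
  have mj: "pd (Inl i) (mop j R) = (\<lambda>X. pd (Inl i) R X - X (Inr j) * pd (Inl i) (pd (Inl j) R) X)"
    unfolding mop_def
    by (simp add: R pd_diff pd_mult pd_coord real_poly_fun.intros real_poly_fun_pd mult.commute)
  have upd: "(\<lambda>k. complex_of_real ((Z(Inr i := u, Inr j := w)) k))
      = (\<lambda>k. of_real (Z k))(Inr i := of_real u, Inr j := of_real w)" for Z u w
    by auto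
  show thesis
  proof (rule that[of "?v R" "?v (pd (Inl i) R)" "?v (pd (Inl j) R)" "?v (pd (Inl i) (pd (Inl j) R))"])
    fix Z :: "coord \<Rightarrow> real"
    show "?v G Z = ?v R Z - Z (Inr i) * ?v (pd (Inl i) R) Z - Z (Inr j) * ?v (pd (Inl j) R) Z
        + Z (Inr i) * Z (Inr j) * ?v (pd (Inl i) (pd (Inl j) R)) Z"
      unfolding GR mop_def[of i] mj by (simp add: mop_def algebra_simps)
  next
    fix f Z u w
    assume "f \<in> {?v R, ?v (pd (Inl i) R), ?v (pd (Inl j) R), ?v (pd (Inl i) (pd (Inl j) R))}"
    then show "f (Z(Inr i := u, Inr j := w)) = f Z"
      by (auto simp only: insert_iff empty_iff upd cong cong'[OF cong] cong'[OF cong'[OF cong]])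
  qed (intro has_real_derivative_pd R real_poly_fun_pd)+
qed

end

text \<open>This serves to reach the parameter at which G vanishes from smaller ones that are known
  to give points of Q.\<close>

lemma affine_nonneg_limit:
  fixes c f k :: real
  assumes "\<And>b. b < f \<Longrightarrow> c - b * k \<ge> 0"
  shows "c - f * k \<ge> 0"
proof (rule tendsto_lowerbound)
  show "((\<lambda>b. c - b * k) \<longlongrightarrow> c - f * k) (at_left f)"
    by (intro tendsto_intros)
  show "eventually (\<lambda>b. 0 \<le> c - b * k) (at_left f)"
    using assms by (auto simp: eventually_at_left_field intro: exI[of _ "f - 1"])
qed simp

context stable_poly
begin

text \<open>The hypotheses of \<open>barrier_inequality\<close> are read off from Q at the point
  shifted by \<nu>: the two given points yield A - \<mu> A' > 0 and A - \<mu> B > 0, monotonicity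
  yields the signs of B and B', and convexity yields the differential inequality
  \<open>B1\<close>.\<close>

lemma Q_step:
  assumes i: "i < m" and j: "j < m" and ij: "i \<noteq> j"
    and \<mu>: "\<mu> > 1" and \<nu>: "\<nu> = \<mu> / (\<mu> - 1)"
    and Pi: "P(Inr i := \<mu>, Inr j := 0) \<in> Q" and Pj: "P(Inr i := 0, Inr j := \<mu>) \<in> Q"
  shows "P(Inl i := P (Inl i) + \<nu>, Inr i := 1, Inr j := \<mu>) \<in> Q"
  unfolding closed_cone_def
proof (intro CollectI allI impI)
  fix s :: real assume s: "s > 0"
  \<comment> \<open>The shift by s times (1, 0) is absorbed into the base point, so that for each s
    only one value of G has to be shown nonzero.\<close>
  define P' where "P' = (\<lambda>k. P k + s * one_zero k)"
  define W0 where "W0 \<sigma> u w = P(Inl i := P (Inl i) + \<sigma>, Inr i := u, Inr j := w)" for \<sigma> u w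
  define W where "W \<sigma> u w = P'(Inl i := P' (Inl i) + \<sigma>, Inr i := u, Inr j := w)" for \<sigma> u w
  have W_W0: "W \<sigma> u w k = W0 \<sigma> u w k + s * one_zero k" for \<sigma> u w k
    by (auto simp: W_def W0_def P'_def one_zero_def)
  have \<nu>0: "\<nu> > 0" using \<mu> \<nu> by simp
  obtain r ri rj rij where
    G: "\<And>Z. Re (G (\<lambda>k. of_real (Z k))) =
      r Z - Z (Inr i) * ri Z - Z (Inr j) * rj Z + Z (Inr i) * Z (Inr j) * rij Z" and
    indep: "\<And>f Z u w. f \<in> {r, ri, rj, rij} \<Longrightarrow> f (Z(Inr i := u, Inr j := w)) = f Z" and
    der: "\<And>Z. ((\<lambda>\<sigma>. r (Z(Inl i := \<sigma>))) has_real_derivative ri Z) (at (Z (Inl i)))"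
      "\<And>Z. ((\<lambda>\<sigma>. rj (Z(Inl i := \<sigma>))) has_real_derivative rij Z) (at (Z (Inl i)))"
    using G_bilinear[OF i j ij] by metis
  define Z where "Z \<sigma> = P'(Inl i := P' (Inl i) + \<sigma>)" for \<sigma>
  define A A' B B' where "A \<sigma> = r (Z \<sigma>)" and "A' \<sigma> = ri (Z \<sigma>)"
    and "B \<sigma> = rj (Z \<sigma>)" and "B' \<sigma> = rij (Z \<sigma>)" for \<sigma>
  have GW: "Re (G (\<lambda>k. of_real (W \<sigma> u w k))) = A \<sigma> - u * A' \<sigma> - w * B \<sigma> + u * w * B' \<sigma>" for \<sigma> u w
  proof -
    have "f (W \<sigma> u w) = f (Z \<sigma>)" if "f \<in> {r, ri, rj, rij}" for f
      unfolding W_def Z_def by (rule indep[OF that])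
    then have "r (W \<sigma> u w) = r (Z \<sigma>)" "ri (W \<sigma> u w) = ri (Z \<sigma>)"
      "rj (W \<sigma> u w) = rj (Z \<sigma>)" "rij (W \<sigma> u w) = rij (Z \<sigma>)"
      by simp_all
    moreover have "W \<sigma> u w (Inr i) = u" "W \<sigma> u w (Inr j) = w"
      by (simp_all add: W_def ij)
    ultimately show ?thesis
      unfolding G A_def A'_def B_def B'_def by simp
  qed
  have shift: "((\<lambda>\<sigma>. P' (Inl i) + \<sigma>) has_real_derivative 1) (at \<sigma>)" for \<sigma>
    by (auto intro!: derivative_eq_intros)
  have dA: "(A has_real_derivative A' \<sigma>) (at \<sigma>)" for \<sigma>
    using DERIV_chain2[OF _ shift, of "\<lambda>x. r (P'(Inl i := x))" "ri (Z \<sigma>)" \<sigma>] der(1)[of "Z \<sigma>"]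
    unfolding A_def A'_def Z_def by simp
  have dB: "(B has_real_derivative B' \<sigma>) (at \<sigma>)" for \<sigma>
    using DERIV_chain2[OF _ shift, of "\<lambda>x. rj (P'(Inl i := x))" "rij (Z \<sigma>)" \<sigma>] der(2)[of "Z \<sigma>"]
    unfolding B_def B'_def Z_def by simp
  have pos: "A \<sigma> - u * A' \<sigma> - w * B \<sigma> + u * w * B' \<sigma> > 0" if "W0 \<sigma> u w \<in> Q" for \<sigma> u w
    using Q_pos[OF that s] unfolding W_W0[symmetric] GW .
  have mono: "W0 \<sigma>' u' w' \<in> Q" if "W0 \<sigma> u w \<in> Q" "\<sigma> \<le> \<sigma>'" "u' \<le> u" "w' \<le> w" for \<sigma> u w \<sigma>' u' w'
  proof -
    have "(\<lambda>k. 0)(Inl i := \<sigma>' - \<sigma>, Inr i := u' - u, Inr j := w' - w) \<in> Q"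
      using that by (intro Q_orthant) auto
    from Q_add[OF that(1) this] show ?thesis
      by (rule back_subst[of "\<lambda>Y. Y \<in> Q"]) (auto simp: W0_def)
  qed
  have W0i: "W0 0 \<mu> 0 \<in> Q" and W0j: "W0 0 0 \<mu> \<in> Q"
    using Pi Pj unfolding W0_def by simp_all
  have \<nu>00: "W0 \<nu> 0 0 \<in> Q" using mono[OF W0i] \<nu>0 \<mu> by simp
  have A: "A \<nu> > 0" using pos[OF \<nu>00] by simp
  have A1: "A \<nu> - \<mu> * A' \<nu> > 0" using pos[OF mono[OF W0i], of \<nu> \<mu> 0] \<nu>0 by simp
  have A2: "A \<nu> - \<mu> * B \<nu> > 0" using pos[OF mono[OF W0j], of \<nu> 0 \<mu>] \<nu>0 by simp
  \<comment> \<open>Lowering y_j stays in Q. If B were negative, the admissible value y_j = A/B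
    \<le> 0 would make A - y_j B vanish.\<close>
  have B: "B \<nu> \<ge> 0"
  proof (rule ccontr)
    assume neg: "\<not> B \<nu> \<ge> 0"
    have "A \<nu> - (A \<nu> / B \<nu>) * B \<nu> > 0"
      using pos[OF mono[OF \<nu>00], of \<nu> 0 "A \<nu> / B \<nu>"] A neg by (simp add: divide_le_0_iff)
    then show False using neg by simp
  qed
  \<comment> \<open>When B = 0, only the mixed term depends on y_j; y_i = -1 switches it on, and a
    sufficiently negative y_j would then contradict positivity.\<close>
  have B0: "B' \<nu> \<ge> 0" if "B \<nu> = 0"
  proof (rule ccontr)
    assume neg: "\<not> B' \<nu> \<ge> 0"
    define b where "b = \<bar>A \<nu> + A' \<nu>\<bar> / B' \<nu>"
    have "b \<le> 0" using neg by (simp add: b_def divide_le_0_iff)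
    then have "A \<nu> + A' \<nu> - b * B' \<nu> > 0"
      using pos[OF mono[OF \<nu>00], of \<nu> "-1" b] that by simp
    moreover have "b * B' \<nu> = \<bar>A \<nu> + A' \<nu>\<bar>" using neg by (simp add: b_def)
    ultimately show False by simp
  qed
  \<comment> \<open>For f = A/B the point \<open>W \<nu> 0 f\<close> is a zero of G on the boundary of the convex cone Q, so the
    derivative of G there in the direction of any other point of Q is nonnegative.\<close>
  have B1: "\<nu> * (A' \<nu> * B \<nu> - A \<nu> * B' \<nu>) \<le> (A \<nu> - \<mu> * B \<nu>) * B \<nu>" if Bpos: "B \<nu> > 0"
  proof -
    define f where "f = A \<nu> / B \<nu>"
    have fB: "f * B \<nu> = A \<nu>" using Bpos by (simp add: f_def)
    \<comment> \<open>In y_j alone G is A - y_j B, whose only zero is f, so the segment from y_j = 0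
      to b stays in one component.\<close>
    have below: "W \<nu> 0 b \<in> Q" if b: "b < f" for b
      unfolding closed_cone_def
    proof (intro CollectI allI impI)
      fix t :: real assume t: "t > 0"
      show "G (\<lambda>k. of_real (W \<nu> 0 b k + t * one_zero k)) \<noteq> 0"
      proof (rule hyp_dir_component[where F = G and A = "W \<nu> 0 0", OF poly_G homog_G hyp_dir_G])
        fix t :: real assume "t \<ge> 0"
        then have "s + t > 0" using s by simp
        then have "G (\<lambda>k. of_real (W0 \<nu> 0 0 k + (s + t) * one_zero k)) \<noteq> 0"
          using \<nu>00 unfolding closed_cone_def by blast
        then show "G (\<lambda>k. of_real (W \<nu> 0 0 k + t * one_zero k)) \<noteq> 0"
          by (simp add: W_W0 algebra_simps)
      next
        fix \<tau> :: real assume \<tau>: "0 \<le> \<tau>" "\<tau> \<le> 1"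
        have "(\<tau> * b) * B \<nu> < A \<nu>"
        proof (cases "b \<le> 0")
          case True
          then have "(\<tau> * b) * B \<nu> \<le> 0"
            using \<tau> Bpos by (simp add: mult_nonneg_nonpos mult_nonpos_nonneg)
          then show ?thesis using A by simp
        next
          case False
          then have "(\<tau> * b) * B \<nu> \<le> b * B \<nu>" using \<tau> Bpos by simp
          also have "\<dots> < f * B \<nu>" using b Bpos by simp
          finally show ?thesis using fB by simp
        qed
        then have "Re (G (\<lambda>k. of_real (W \<nu> 0 (\<tau> * b) k))) \<noteq> 0"
          unfolding GW by simp
        moreover have "W \<nu> 0 (\<tau> * b) k = W \<nu> 0 0 k + \<tau> * (W \<nu> 0 b k - W \<nu> 0 0 k)" for k
          by (simp add: W_def)
        ultimately show "G (\<lambda>k. of_real (W \<nu> 0 0 k + \<tau> * (W \<nu> 0 b k - W \<nu> 0 0 k))) \<noteq> 0"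
          by auto
      qed (use t in simp)
    qed
    have "one_zero \<in> Q" by (rule Q_orthant) (simp_all add: one_zero_def)
    from Q_add[OF W0j Q_scale[OF this, of s]] have W0: "W 0 0 \<mu> \<in> Q"
      using s by (simp add: W_W0[symmetric])
    \<comment> \<open>This is G along the segment from \<open>W \<nu> 0 f\<close> to
      \<open>W 0 0 \<mu>\<close>: the shift of z_i falls from \<nu> to 0 while y_j moves from f to
      \<mu>.\<close>
    define \<phi> where "\<phi> \<tau> = A ((1 - \<tau>) * \<nu>) - (f - \<tau> * (f - \<mu>)) * B ((1 - \<tau>) * \<nu>)" for \<tau>
    have "\<phi> \<tau> \<ge> 0" if \<tau>: "0 \<le> \<tau>" "\<tau> \<le> 1" for \<tau>
    proof -
      have "A ((1 - \<tau>) * \<nu>) - \<tau> * \<mu> * B ((1 - \<tau>) * \<nu>) - b * ((1 - \<tau>) * B ((1 - \<tau>) * \<nu>)) \<ge> 0"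
        if b: "b < f" for b
      proof -
        have "(\<lambda>k. (1 - \<tau>) * W \<nu> 0 b k + \<tau> * W 0 0 \<mu> k) \<in> Q"
          using Q_add[OF Q_scale[OF below[OF b], of "1 - \<tau>"] Q_scale[OF W0, of \<tau>]] \<tau> by simp
        moreover have "(1 - \<tau>) * W \<nu> 0 b k + \<tau> * W 0 0 \<mu> k
            = W ((1 - \<tau>) * \<nu>) 0 ((1 - \<tau>) * b + \<tau> * \<mu>) k" for k
          by (simp add: W_def algebra_simps)
        ultimately have "W ((1 - \<tau>) * \<nu>) 0 ((1 - \<tau>) * b + \<tau> * \<mu>) \<in> Q" by simp
        from Q_nonneg[OF this] show ?thesis unfolding GW by (simp add: algebra_simps)
      qed
      from affine_nonneg_limit[OF this, of f] show ?thesis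
        by (simp add: \<phi>_def algebra_simps)
    qed
    moreover have "\<phi> 0 = 0" using fB by (simp add: \<phi>_def)
    moreover have d\<phi>: "(\<phi> has_real_derivative
        (- \<nu> * A' \<nu> + (f - \<mu>) * B \<nu> + f * \<nu> * B' \<nu>)) (at 0)"
    proof -
      have l: "((\<lambda>\<tau>. (1 - \<tau>) * \<nu>) has_real_derivative - \<nu>) (at 0)"
        by (auto intro!: derivative_eq_intros)
      have "((\<lambda>\<tau>. A ((1 - \<tau>) * \<nu>)) has_real_derivative A' \<nu> * (- \<nu>)) (at 0)"
        by (rule DERIV_chain2[OF _ l]) (use dA[of \<nu>] in simp)
      moreover have "((\<lambda>\<tau>. B ((1 - \<tau>) * \<nu>)) has_real_derivative B' \<nu> * (- \<nu>)) (at 0)"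
        by (rule DERIV_chain2[OF _ l]) (use dB[of \<nu>] in simp)
      ultimately show ?thesis
        unfolding \<phi>_def by (auto intro!: derivative_eq_intros simp: algebra_simps)
    qed
    ultimately have "- \<nu> * A' \<nu> + (f - \<mu>) * B \<nu> + f * \<nu> * B' \<nu> \<ge> 0" (is "?l \<ge> 0")
    proof -
      assume nn: "\<And>\<tau>. 0 \<le> \<tau> \<Longrightarrow> \<tau> \<le> 1 \<Longrightarrow> \<phi> \<tau> \<ge> 0" and z: "\<phi> 0 = 0"
      show ?thesis
      proof (rule ccontr)
        assume "\<not> ?l \<ge> 0"
        then obtain \<delta> where \<delta>: "\<delta> > 0" "\<And>h. 0 < h \<Longrightarrow> h < \<delta> \<Longrightarrow> \<phi> (0 + h) < \<phi> 0"
          using has_real_derivative_neg_dec_right[of \<phi> ?l 0 UNIV] d\<phi> by auto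
        obtain h where "0 < h" "h < \<delta>" "h \<le> 1"
          using \<delta>(1) by (metis dense less_le_trans min.bounded_iff min_less_iff_conj order_less_imp_le zero_less_one)
        then show False using \<delta>(2)[of h] nn[of h] z by simp
      qed
    qed
    then have "?l * B \<nu> \<ge> 0" using Bpos by simp
    moreover have "?l * B \<nu> = - \<nu> * (A' \<nu> * B \<nu>) + (f * B \<nu> - \<mu> * B \<nu>) * B \<nu> + (f * B \<nu>) * \<nu> * B' \<nu>"
      by (simp add: algebra_simps)
    ultimately show ?thesis unfolding fB by (simp add: algebra_simps)
  qed
  have "A \<nu> - A' \<nu> - \<mu> * B \<nu> + \<mu> * B' \<nu> > 0"
    using barrier_inequality[OF \<mu> \<nu> less_imp_le[OF A1] A2 B B0 B1] by simp
  then have "Re (G (\<lambda>k. of_real (W \<nu> 1 \<mu> k))) \<noteq> 0"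
    unfolding GW by simp
  then show "G (\<lambda>k. of_real ((P(Inl i := P (Inl i) + \<nu>, Inr i := 1, Inr j := \<mu>)) k + s * one_zero k)) \<noteq> 0"
    unfolding W_W0 W0_def by auto
qed

text \<open>Since H is 1 at (1, 0), this is also the logarithmic derivative there; for the
  restricted hyperbolic polynomial it is the trace of v_j.\<close>

definition slope :: "nat \<Rightarrow> real" where
  "slope j = Re (pd (Inl j) H (\<lambda>k. of_real (one_zero k)))"

text \<open>The indices in S have been treated, each at the price \<nu> in its own z-coordinate. An
  index j outside S carries the value \<mu>, which records the barrier in direction j.\<close>

definition barrier_point :: "real \<Rightarrow> real \<Rightarrow> real \<Rightarrow> nat set \<Rightarrow> nat \<Rightarrow> coord \<Rightarrow> real" where
  "barrier_point t \<mu> \<nu> S j = case_sum (\<lambda>l. t + (if l \<in> S then \<nu> else 0))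
     (\<lambda>l. if l \<in> S then 1 else if l = j then \<mu> else 0)"

text \<open>On the diagonal homogeneity evaluates everything: with T = t + s one gets T G = T^d (T -
  \<mu> \<partial>_j H(1)), and T exceeds \<mu> times the slope.\<close>

lemma barrier_point_empty:
  assumes j: "j < m" and \<mu>: "\<mu> > 0" and t: "t \<ge> \<mu> * slope j" "t \<ge> 0"
  shows "barrier_point t \<mu> \<nu> {} j \<in> Q"
  unfolding closed_cone_def
proof (intro CollectI allI impI)
  fix s :: real assume s: "s > 0"
  define X where "X = (\<lambda>k. complex_of_real (barrier_point t \<mu> \<nu> {} j k + s * one_zero k))"
  define T where "T = complex_of_real (t + s)"
  have T: "T \<noteq> 0" using s t unfolding T_def of_real_eq_0_iff by simp
  obtain xs where xs: "G = mop j (foldr mop xs H)" "j \<notin> set xs" "set xs = {..<m} - {j}"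
    using G_move_front[OF j] by metis
  have Xr: "X (Inr l) = (if l = j then of_real \<mu> else 0)" for l
    by (simp add: X_def barrier_point_def one_zero_def)
  have Xl: "X (Inl l) = T * of_real (one_zero (Inl l))" for l
    by (simp add: X_def T_def barrier_point_def one_zero_def)
  have "foldr mop xs H X = H X"
    by (rule mops_zero) (use xs Xr in auto)
  also have "\<dots> = H (\<lambda>k. T * of_real (one_zero k))"
    by (rule cong_H) (rule Xl)
  also have "\<dots> = T ^ d"
    using homogD[OF homog_H T] norm_H by simp
  finally have HX: "foldr mop xs H X = T ^ d" .
  have "pd (Inl j) (foldr mop xs H) X = pd (Inl j) H (\<lambda>k. T * of_real (one_zero k))"
  proof (rule pd_cong)
    fix s
    have "foldr mop xs H (X(Inl j := s)) = H (X(Inl j := s))"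
      by (rule mops_zero) (use xs Xr in auto)
    also have "\<dots> = H ((\<lambda>k. T * of_real (one_zero k))(Inl j := s))"
      by (rule cong_H) (simp add: Xl)
    finally show "foldr mop xs H (X(Inl j := s)) = H ((\<lambda>k. T * of_real (one_zero k))(Inl j := s))" .
  qed (rule Xl)
  then have "T * pd (Inl j) (foldr mop xs H) X = T ^ d * pd (Inl j) H (\<lambda>k. of_real (one_zero k))"
    using pd_homog[OF poly_H homog_H T, of "Inl j"] by simp
  then have "T * G X = T ^ d * (T - of_real \<mu> * pd (Inl j) H (\<lambda>k. of_real (one_zero k)))"
    unfolding xs(1) mop_def[of j] HX Xr by (simp add: algebra_simps)
  moreover have "Re (T - of_real \<mu> * pd (Inl j) H (\<lambda>k. of_real (one_zero k))) > 0"
    using s t by (simp add: T_def slope_def)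
  then have "T - of_real \<mu> * pd (Inl j) H (\<lambda>k. of_real (one_zero k)) \<noteq> 0"
    by (metis less_irrefl zero_complex.sel(1))
  ultimately have "T * G X \<noteq> 0" using T by simp
  then show "G (\<lambda>k. of_real (barrier_point t \<mu> \<nu> {} j k + s * one_zero k)) \<noteq> 0"
    by (simp add: X_def)
qed

text \<open>Adding i while keeping j consumes the barrier points of both indices, so the induction
  carries all j outside S at once.\<close>

lemma barrier_point_in_Q:
  assumes \<mu>: "\<mu> > 1" and \<nu>: "\<nu> = \<mu> / (\<mu> - 1)"
    and t: "\<And>j. j < m \<Longrightarrow> t \<ge> \<mu> * slope j" "t \<ge> 0"
  shows "finite S \<Longrightarrow> S \<subseteq> {..<m} \<Longrightarrow> j < m \<Longrightarrow> j \<notin> S \<Longrightarrow> barrier_point t \<mu> \<nu> S j \<in> Q"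
proof (induction S arbitrary: j rule: finite_induct)
  case empty
  then show ?case using barrier_point_empty t \<mu> by simp
next
  case (insert i S)
  define P where "P = case_sum (\<lambda>l. t + (if l \<in> S then \<nu> else 0)) (\<lambda>l. if l \<in> S then 1 else 0 :: real)"
  have "P(Inl i := P (Inl i) + \<nu>, Inr i := 1, Inr j := \<mu>) \<in> Q"
  proof (rule Q_step[OF _ _ _ \<mu> \<nu>])
    have "barrier_point t \<mu> \<nu> S i \<in> Q" using insert by simp
    then show "P(Inr i := \<mu>, Inr j := 0) \<in> Q"
      by (rule back_subst[of "\<lambda>Y. Y \<in> Q"])
        (use insert in \<open>auto simp: P_def barrier_point_def split: sum.split\<close>)
    have "barrier_point t \<mu> \<nu> S j \<in> Q" using insert by simp
    then show "P(Inr i := 0, Inr j := \<mu>) \<in> Q"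
      by (rule back_subst[of "\<lambda>Y. Y \<in> Q"])
        (use insert in \<open>auto simp: P_def barrier_point_def split: sum.split\<close>)
  qed (use insert in auto)
  then show ?case
    by (rule back_subst[of "\<lambda>Y. Y \<in> Q"])
      (use insert in \<open>auto simp: P_def barrier_point_def split: sum.split\<close>)
qed

text \<open>In each coordinate below m the points add up to y = (m - 1) + \<mu> = c and z = m t + (m
  - 1) \<nu> = N. After division by c, a zero at T > N/c would be a point of Q moved by a positive
  multiple of (1, 0), where G cannot vanish.\<close>

lemma largest_root_bound:
  assumes \<mu>: "\<mu> > 1" and m: "m > 0" and \<epsilon>: "\<epsilon> \<ge> 0" "\<And>j. j < m \<Longrightarrow> slope j \<le> \<epsilon>"
    and zero: "G (\<lambda>k. of_real (case_sum (\<lambda>_. T) (\<lambda>_. 1) k)) = 0"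
  shows "T * (real m - 1 + \<mu>) \<le> real m * \<epsilon> * \<mu> + (real m - 1) * (\<mu> / (\<mu> - 1))"
proof (rule ccontr)
  define \<nu> where "\<nu> = \<mu> / (\<mu> - 1)"
  define t where "t = \<epsilon> * \<mu>"
  define c where "c = real m - 1 + \<mu>"
  define N where "N = real m * t + (real m - 1) * \<nu>"
  assume "\<not> ?thesis"
  then have gt: "N < T * c" by (simp add: N_def c_def \<nu>_def t_def mult.assoc)
  have c: "c > 0" using m \<mu> by (simp add: c_def)
  have t: "t \<ge> \<mu> * slope j" if "j < m" for j
    using \<epsilon>(2)[OF that] \<mu> by (simp add: t_def)
  have "t \<ge> 0" using \<epsilon> \<mu> by (simp add: t_def)
  then have "barrier_point t \<mu> \<nu> ({..<m} - {j}) j \<in> Q" if "j < m" for j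
    using barrier_point_in_Q[OF \<mu> \<nu>_def t] that by auto
  then have sum: "(\<lambda>k. \<Sum>j<m. barrier_point t \<mu> \<nu> ({..<m} - {j}) j k) \<in> Q"
    by (intro Q_sum) simp
  have count: "(\<Sum>j<m. if l \<noteq> j then a else b) = (real m - 1) * a + b" if "l < m" for l and a b :: real
  proof -
    have "(\<Sum>j<m. if l \<noteq> j then a else b) = b + (\<Sum>j\<in>{..<m} - {l}. a)"
      using that by (subst sum.remove[of _ l]) (auto intro!: sum.cong)
    then show ?thesis using that by (simp add: of_nat_diff)
  qed
  \<comment> \<open>\<open>D\<close> vanishes at indices below m. It corrects the coordinates of
    index at least m, on which \<open>Q_orthant\<close> imposes no condition.\<close>
  define D where "D = (\<lambda>k. c * case_sum (\<lambda>_. N / c) (\<lambda>_. 1) k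
    - (\<Sum>j<m. barrier_point t \<mu> \<nu> ({..<m} - {j}) j k))"
  have "D \<in> Q"
  proof (rule Q_orthant)
    fix l assume l: "l < m"
    have "(\<Sum>j<m. barrier_point t \<mu> \<nu> ({..<m} - {j}) j (Inl l)) = (\<Sum>j<m. if l \<noteq> j then t + \<nu> else t)"
      by (rule sum.cong) (use l in \<open>auto simp: barrier_point_def\<close>)
    also have "\<dots> = N" unfolding count[OF l] N_def by (simp add: algebra_simps)
    finally show "D (Inl l) \<ge> 0" using c by (simp add: D_def)
    have "(\<Sum>j<m. barrier_point t \<mu> \<nu> ({..<m} - {j}) j (Inr l)) = (\<Sum>j<m. if l \<noteq> j then 1 else \<mu>)"
      by (rule sum.cong) (use l in \<open>auto simp: barrier_point_def\<close>)
    also have "\<dots> = c" unfolding count[OF l] c_def by simp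
    finally show "D (Inr l) \<le> 0" by (simp add: D_def)
  qed
  from Q_add[OF sum this] have "(\<lambda>k. c * case_sum (\<lambda>_. N / c) (\<lambda>_. 1) k) \<in> Q"
    by (simp add: D_def)
  from Q_scale[OF this, of "1 / c"] have "case_sum (\<lambda>_. N / c) (\<lambda>_. 1) \<in> Q"
    using c by simp
  moreover have "T - N / c > 0" using gt c by (simp add: field_simps)
  ultimately have "G (\<lambda>k. of_real (case_sum (\<lambda>_. N / c) (\<lambda>_. 1) k + (T - N / c) * one_zero k)) \<noteq> 0"
    unfolding closed_cone_def by blast
  moreover have "case_sum (\<lambda>_. N / c) (\<lambda>_. 1) k + (T - N / c) * one_zero k = case_sum (\<lambda>_. T) (\<lambda>_. 1) k" for k
    by (simp add: one_zero_def split: sum.split)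
  ultimately show False using zero by simp
qed

end

section \<open>Hyperbolic polynomials\<close>

definition complex_eval :: "(('n::finite \<Rightarrow> nat) \<Rightarrow> real) \<Rightarrow> ('n \<Rightarrow> complex) \<Rightarrow> complex" where
  "complex_eval c X = (\<Sum>\<alpha>\<in>{\<alpha>. c \<alpha> \<noteq> 0}. of_real (c \<alpha>) * (\<Prod>i\<in>UNIV. X i ^ \<alpha> i))"

lemma real_poly_fun_complex_eval: "real_poly_fun (complex_eval c)"
  unfolding complex_eval_def
  by (intro real_poly_fun_sum real_poly_fun.intros real_poly_fun_prod real_poly_fun_power)

lemma homog_complex_eval: "homogeneous_poly c d \<Longrightarrow> homog d (complex_eval c)"
  unfolding homog_def complex_eval_def homogeneous_poly_def
  by (auto simp: power_mult_distrib prod.distrib sum_distrib_left simp flip: power_sum intro!: sum.cong)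

lemma complex_eval_of_real: "complex_eval c (\<lambda>i. of_real (x $ i)) = of_real (mpoly_eval c x)"
  by (simp add: complex_eval_def mpoly_eval_def)

section \<open>Characteristic polynomials over the complex numbers\<close>

lemma map_poly_of_real_mult:
  "map_poly complex_of_real (p * q) = map_poly of_real p * map_poly of_real q"
  by (intro poly_eqI) (simp_all add: coeff_map_poly coeff_mult)

lemma map_poly_of_real_add:
  "map_poly complex_of_real (p + q) = map_poly of_real p + map_poly of_real q"
  by (intro poly_eqI) (simp_all add: coeff_map_poly)

lemma map_poly_of_real_sum:
  "map_poly complex_of_real (\<Sum>a\<in>S. f a) = (\<Sum>a\<in>S. map_poly of_real (f a))"
  by (induction S rule: infinite_finite_induct) (simp_all add: map_poly_of_real_add)

lemma map_poly_of_real_prod: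
  "map_poly complex_of_real (\<Prod>a\<in>S. f a) = (\<Prod>a\<in>S. map_poly of_real (f a))"
  by (induction S rule: infinite_finite_induct) (simp_all add: map_poly_of_real_mult)

lemma map_poly_of_real_power: "map_poly complex_of_real (p ^ n) = map_poly of_real p ^ n"
  by (induction n) (simp_all add: map_poly_of_real_mult)

lemma poly_map_poly_of_real: "poly (map_poly complex_of_real p) (of_real r) = of_real (poly p r)"
  by (induction p) (simp_all add: map_poly_pCons)

lemma poly_char_poly_complex:
  "poly (map_poly complex_of_real (char_poly c e x)) z
    = complex_eval c (\<lambda>i. of_real (- x $ i) + z * of_real (e $ i))"
  by (simp add: char_poly_def complex_eval_def map_poly_of_real_sum map_poly_smult
      map_poly_of_real_prod map_poly_of_real_power map_poly_pCons poly_sum poly_prod)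

lemma poly_char_poly: "poly (char_poly c e x) r = mpoly_eval c (r *\<^sub>R e - x)"
  by (simp add: char_poly_def mpoly_eval_def poly_sum poly_prod)

lemma mpoly_eval_scale:
  assumes "homogeneous_poly c d" "r \<noteq> 0"
  shows "mpoly_eval c (r *\<^sub>R x) = r ^ d * mpoly_eval c x"
proof -
  have "complex_of_real (mpoly_eval c (r *\<^sub>R x)) = of_real (r ^ d * mpoly_eval c x)"
    using homogD[OF homog_complex_eval[OF assms(1)], of "of_real r" "\<lambda>i. of_real (x $ i)"] assms(2)
    by (simp add: complex_eval_of_real flip: complex_eval_of_real)
  then show ?thesis by (simp only: of_real_eq_iff)
qed

lemma hyp_dir_complex_eval:
  assumes "hyperbolic c d e"
  shows "hyp_dir (complex_eval c) (\<lambda>i. e $ i)"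
  unfolding hyp_dir_def
proof (intro allI impI)
  fix x :: "'a \<Rightarrow> real" and z assume "Im z > 0"
  then have "z \<notin> \<real>" by (auto simp: complex_is_Real_iff)
  then have "poly (map_poly complex_of_real (char_poly c e (\<chi> i. - x i))) z \<noteq> 0"
    using assms unfolding hyperbolic_def by blast
  then show "complex_eval c (\<lambda>k. of_real (x k) + z * of_real (e $ k)) \<noteq> 0"
    by (simp add: poly_char_poly_complex)
qed

text \<open>By homogeneity h(v + s e) = (-1)^d h(-s e - v), and -s < 0 is not an eigenvalue of
  v.\<close>

lemma hyp_cone_closed_cone:
  assumes hyp: "hyperbolic c d e" and v: "v \<in> hyp_cone c e"
  shows "(\<lambda>i. v $ i) \<in> closed_cone (complex_eval c) (\<lambda>i. e $ i)"
  unfolding closed_cone_def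
proof (intro CollectI allI impI)
  fix s :: real assume s: "s > 0"
  have "poly (char_poly c e v) (- s) \<noteq> 0"
    using v s unfolding hyp_cone_def by force
  moreover have "(- s) *\<^sub>R e - v = (-1) *\<^sub>R (v + s *\<^sub>R e)"
    by (simp add: algebra_simps)
  ultimately have "mpoly_eval c ((-1) *\<^sub>R (v + s *\<^sub>R e)) \<noteq> 0"
    by (metis poly_char_poly)
  then have "mpoly_eval c (v + s *\<^sub>R e) \<noteq> 0"
    using mpoly_eval_scale[of c d "-1" "v + s *\<^sub>R e"] hyp unfolding hyperbolic_def by auto
  then show "complex_eval c (\<lambda>k. of_real (v $ k + s * e $ k)) \<noteq> 0"
    using complex_eval_of_real[of c "v + s *\<^sub>R e"] by simp
qed

section \<open>Eigenvalues, traces and derivatives at e\<close>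

lemma real_rooted_factorization:
  fixes p :: "real poly"
  assumes "\<And>z. poly (map_poly complex_of_real p) z = 0 \<Longrightarrow> z \<in> \<real>" "p \<noteq> 0"
  shows "p = smult (lead_coeff p) (\<Prod>x\<in>#proots p. [:-x, 1:])"
  using assms
proof (induction "degree p" arbitrary: p)
  case 0
  then obtain a where "p = [:a:]" by (metis degree_0_id)
  then show ?case by simp
next
  case (Suc n)
  have "degree (map_poly complex_of_real p) = degree p"
    by (intro degree_map_poly) simp_all
  then have "\<not> constant (poly (map_poly complex_of_real p))"
    using Suc.hyps(2) by (simp add: constant_degree)
  then obtain z where z: "poly (map_poly complex_of_real p) z = 0"
    using fundamental_theorem_of_algebra by blast
  then obtain x where "z = of_real x" using Suc.prems by (metis Reals_cases)
  then have "poly p x = 0" using z by (simp add: poly_map_poly_of_real)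
  then obtain q where q: "p = [:-x, 1:] * q"
    by (metis dvdE poly_eq_0_iff_dvd)
  have "q \<noteq> 0" using Suc.hyps(2) q by auto
  then have deg: "degree p = Suc (degree q)"
    unfolding q by (subst degree_mult_eq) auto
  have "z \<in> \<real>" if "poly (map_poly complex_of_real q) z = 0" for z
    using Suc.prems(1)[of z] that unfolding q map_poly_of_real_mult by simp
  then have "q = smult (lead_coeff q) (\<Prod>x\<in>#proots q. [:-x, 1:])"
    using Suc.hyps deg \<open>q \<noteq> 0\<close> by auto
  moreover have "proots p = add_mset x (proots q)"
    unfolding q using \<open>q \<noteq> 0\<close> by (subst proots_mult) auto
  moreover have "lead_coeff p = lead_coeff q"
    unfolding q by (simp only: lead_coeff_mult) simp
  ultimately show ?case
    by (metis image_mset_add_mset mult_smult_right prod_mset.add_mset q)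
qed

lemma sum_mset_multiplicity:
  fixes A :: "real multiset"
  shows "sum_mset A = (\<Sum>x\<in>set_mset A. of_nat (count A x) * x)"
proof (induction A)
  case (add x A)
  have "(\<Sum>y\<in>insert x (set_mset A). of_nat (count (add_mset x A) y) * y)
      = (\<Sum>y\<in>insert x (set_mset A). of_nat (count A y) * y + (if y = x then x else 0))"
    by (rule sum.cong) (auto simp: algebra_simps)
  also have "\<dots> = (\<Sum>y\<in>insert x (set_mset A). of_nat (count A y) * y) + x"
    by (simp add: sum.distrib)
  also have "(\<Sum>y\<in>insert x (set_mset A). of_nat (count A y) * y) = (\<Sum>y\<in>set_mset A. of_nat (count A y) * y)"
    by (rule sum.mono_neutral_right) (auto simp: not_in_iff)
  finally show ?case using add by simp
qed simp

lemma hyp_trace_proots: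
  assumes "char_poly c e x \<noteq> 0"
  shows "hyp_trace c e x = sum_mset (proots (char_poly c e x))"
  unfolding hyp_trace_def sum_mset_multiplicity using assms by simp

lemma has_real_derivative_prod_mset:
  "((\<lambda>s. \<Prod>x\<in>#A. 1 + s * x) has_real_derivative sum_mset A) (at 0)"
proof (induction A)
  case (add x A)
  have "((\<lambda>s. (1 + s * x) * (\<Prod>x\<in>#A. 1 + s * x)) has_real_derivative
      x * (\<Prod>x\<in>#A. 1 + 0 * x) + sum_mset A * (1 + 0 * x)) (at 0)"
    by (intro DERIV_mult add) (auto intro!: derivative_eq_intros)
  then show ?case by simp
qed simp

text \<open>The substitution t = -1/s turns the factors t - \<lambda> of the characteristic
  polynomial into the factors 1 + s \<lambda> along the line e + s v.\<close>

lemma prod_mset_reverse: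
  fixes s :: real
  assumes "s \<noteq> 0"
  shows "(- s) ^ size A * (\<Prod>x\<in>#A. - (1 / s) - x) = (\<Prod>x\<in>#A. 1 + s * x)"
proof (induction A)
  case (add x A)
  have "- s * (- (1 / s) - x) = 1 + s * x" using assms by (simp add: field_simps)
  moreover have "(- s) ^ size (add_mset x A) * (\<Prod>x\<in>#add_mset x A. - (1 / s) - x)
      = (- s * (- (1 / s) - x)) * ((- s) ^ size A * (\<Prod>x\<in>#A. - (1 / s) - x))"
    by (simp add: mult_ac)
  ultimately show ?case unfolding add.IH by simp
qed simp

lemma poly_prod_mset_linear:
  "poly (\<Prod>x\<in>#A. [:-x, 1:]) (r :: real) = (\<Prod>x\<in>#A. r - x)"
  by (induction A) (simp_all add: algebra_simps)

lemma degree_prod_mset_linear: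
  "degree (\<Prod>x\<in>#A. [:-x, 1 :: real:]) = size A"
proof (induction A)
  case (add x A)
  have "(\<Prod>x\<in>#A. [:-x, 1 :: real:]) \<noteq> 0"
    by (auto simp: prod_mset_zero_iff)
  then show ?case using add by (simp add: degree_mult_eq del: mult_pCons_left)
qed simp

text \<open>The identity e + s v = -s ((-1/s) e - v) reduces the line through e to the
  characteristic polynomial, which has degree d and leading coefficient h(e).\<close>

lemma mpoly_eval_line:
  assumes hyp: "hyperbolic c d e"
  shows "mpoly_eval c (e + s *\<^sub>R v) = mpoly_eval c e * (\<Prod>x\<in>#proots (char_poly c e v). 1 + s * x)"
    and "char_poly c e v \<noteq> 0"
proof -
  have h: "homogeneous_poly c d" and e: "mpoly_eval c e \<noteq> 0"
    using hyp unfolding hyperbolic_def by auto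
  let ?p = "char_poly c e v" and ?m = "map_poly complex_of_real"
  have "complex_eval c (\<lambda>i. of_real (e $ i)) \<noteq> 0"
    using e by (simp add: complex_eval_of_real)
  from homog_line_poly[where F = "complex_eval c", OF real_poly_fun_complex_eval homog_complex_eval[OF h] this,
      of "\<lambda>i. of_real (- v $ i)"]
  obtain q where q: "degree q = d" "lead_coeff q = complex_eval c (\<lambda>i. of_real (e $ i))"
    "\<And>r. complex_eval c (\<lambda>i. of_real (- v $ i) + r * of_real (e $ i)) = poly q r"
    by blast
  have "poly (?m ?p) = poly q"
    by (rule ext) (simp only: poly_char_poly_complex q(3))
  then have mq: "?m ?p = q" by (simp only: poly_eq_poly_eq_iff)
  have dm: "degree (?m ?p) = degree ?p" by (intro degree_map_poly) simp_all
  have deg: "degree ?p = d" using q(1) mq dm by simp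
  have "complex_of_real (lead_coeff ?p) = of_real (mpoly_eval c e)"
    using q(2) unfolding mq[symmetric] dm by (simp add: coeff_map_poly complex_eval_of_real)
  then have lc: "lead_coeff ?p = mpoly_eval c e" by (simp only: of_real_eq_iff)
  then show nz: "?p \<noteq> 0" using e by auto
  have fact: "?p = smult (lead_coeff ?p) (\<Prod>x\<in>#proots ?p. [:-x, 1:])"
    by (rule real_rooted_factorization[OF _ nz]) (use hyp in \<open>auto simp: hyperbolic_def\<close>)
  then have poly_p: "poly ?p r = mpoly_eval c e * (\<Prod>x\<in>#proots ?p. r - x)" for r
    unfolding lc using poly_prod_mset_linear[of "proots ?p" r] by (metis poly_smult)
  have "size (proots ?p) = d"
    using fact deg e unfolding lc by (metis degree_smult_eq degree_prod_mset_linear)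
  show "mpoly_eval c (e + s *\<^sub>R v) = mpoly_eval c e * (\<Prod>x\<in>#proots ?p. 1 + s * x)"
  proof (cases "s = 0")
    case False
    have "e + s *\<^sub>R v = (- s) *\<^sub>R ((- (1 / s)) *\<^sub>R e - v)"
      using False by (simp add: algebra_simps)
    then have "mpoly_eval c (e + s *\<^sub>R v) = (- s) ^ d * poly ?p (- (1 / s))"
      using mpoly_eval_scale[OF h, of "- s"] False by (simp only: poly_char_poly neg_equal_0_iff_equal not_False_eq_True)
    also have "\<dots> = mpoly_eval c e * ((- s) ^ size (proots ?p) * (\<Prod>x\<in>#proots ?p. - (1 / s) - x))"
      unfolding poly_p \<open>size (proots ?p) = d\<close> by (simp only: mult_ac)
    finally show ?thesis unfolding prod_mset_reverse[OF False] .
  qed simp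
qed

lemma trace_derivative:
  assumes "hyperbolic c d e"
  shows "((\<lambda>s. mpoly_eval c (e + s *\<^sub>R v)) has_real_derivative mpoly_eval c e * hyp_trace c e v) (at 0)"
  unfolding mpoly_eval_line(1)[OF assms] hyp_trace_proots[OF mpoly_eval_line(2)[OF assms]]
  by (intro DERIV_cmult has_real_derivative_prod_mset)

lemma mpoly_eval_differentiable: "mpoly_eval c differentiable (at x)"
proof -
  have monomial: "(\<lambda>x. c \<alpha> * (\<Prod>i\<in>UNIV. (x $ i) ^ \<alpha> i)) differentiable (at x)" for \<alpha>
  proof -
    have "((\<lambda>x. \<Prod>i\<in>UNIV. (x $ i) ^ \<alpha> i) has_derivative
      (\<lambda>y. \<Sum>i\<in>UNIV. (of_nat (\<alpha> i) * (y $ i) * (x $ i) ^ (\<alpha> i - 1)) * (\<Prod>j\<in>UNIV - {i}. (x $ j) ^ \<alpha> j))) (at x)"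
      by (intro has_derivative_prod has_derivative_power bounded_linear_imp_has_derivative
          bounded_linear_vec_nth)
    then show ?thesis
      by (intro differentiable_mult differentiable_const) (auto simp: differentiable_def)
  qed
  show ?thesis
  proof (cases "finite {\<alpha>. c \<alpha> \<noteq> 0}")
    case True
    then show ?thesis
      unfolding mpoly_eval_def by (intro differentiable_sum ballI monomial)
  qed (simp add: mpoly_eval_def[abs_def])
qed

text \<open>The derivative of h at e in direction e is h(e) times the sum of traces by linearity,
  and d h(e) by Euler's identity. Hence m \<epsilon> \<ge> d under the trace bound.\<close>

lemma sum_hyp_trace:
  assumes hyp: "hyperbolic c d e" and vs: "sum_list vs = e"
  shows "(\<Sum>v\<leftarrow>vs. hyp_trace c e v) = real d"
proof -
  have h: "homogeneous_poly c d" and e: "mpoly_eval c e \<noteq> 0"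
    using hyp unfolding hyperbolic_def by auto
  obtain f' where f': "(mpoly_eval c has_derivative f') (at e)"
    using mpoly_eval_differentiable unfolding differentiable_def by blast
  interpret f': bounded_linear f' by (rule has_derivative_bounded_linear[OF f'])
  have line: "((\<lambda>s. mpoly_eval c (e + s *\<^sub>R v)) has_real_derivative f' v) (at 0)" for v
  proof -
    have "((\<lambda>s. e + s *\<^sub>R v) has_derivative (\<lambda>s. s *\<^sub>R v)) (at 0)"
      by (auto intro!: derivative_eq_intros)
    from has_derivative_compose[OF this, of "mpoly_eval c" f'] f' show ?thesis
      by (simp add: has_field_derivative_def f'.scaleR mult_commute_abs)
  qed
  have tr: "f' v = mpoly_eval c e * hyp_trace c e v" for v
    by (rule DERIV_unique[OF line trace_derivative[OF hyp]])
  have "((\<lambda>s. (1 + s) ^ d * mpoly_eval c e) has_real_derivative real d * mpoly_eval c e) (at 0)"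
    by (auto intro!: derivative_eq_intros)
  moreover have ev: "eventually (\<lambda>s. (1 + s) ^ d * mpoly_eval c e = mpoly_eval c (e + s *\<^sub>R e)) (nhds 0)"
  proof -
    have "eventually (\<lambda>s :: real. s > -1) (nhds 0)"
      using eventually_nhds_in_open[of "{-1<..}" "0::real"] by auto
    then show ?thesis
    proof eventually_elim
      case (elim s)
      have "e + s *\<^sub>R e = (1 + s) *\<^sub>R e" by (simp add: algebra_simps)
      then show ?case using mpoly_eval_scale[OF h, of "1 + s" e] elim by simp
    qed
  qed
  ultimately have "((\<lambda>s. mpoly_eval c (e + s *\<^sub>R e)) has_real_derivative real d * mpoly_eval c e) (at 0)"
    using DERIV_cong_ev[OF refl ev refl] by blast
  from DERIV_unique[OF line this] have Euler: "f' e = real d * mpoly_eval c e" .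
  have lin: "f' (sum_list xs) = (\<Sum>v\<leftarrow>xs. f' v)" for xs
    by (induction xs) (simp_all add: f'.zero f'.add)
  have "f' e = (\<Sum>v\<leftarrow>vs. f' v)"
    using lin[of vs] vs by simp
  then have "f' e = mpoly_eval c e * (\<Sum>v\<leftarrow>vs. hyp_trace c e v)"
    unfolding tr by (simp only: sum_list_const_mult)
  then show ?thesis using Euler e by simp
qed

section \<open>Restriction to the span of the vectors\<close>

definition pencil :: "(('n::finite \<Rightarrow> nat) \<Rightarrow> real) \<Rightarrow> real^'n \<Rightarrow> (real^'n) list \<Rightarrow> (coord \<Rightarrow> complex) \<Rightarrow> complex" where
  "pencil c e vs X = of_real (1 / mpoly_eval c e) *
     complex_eval c (\<lambda>i. \<Sum>j<length vs. X (Inl j) * of_real (vs ! j $ i))"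

lemma pencil_of_real:
  "pencil c e vs (\<lambda>k. of_real (Z k)) =
    of_real (mpoly_eval c (\<Sum>j<length vs. Z (Inl j) *\<^sub>R vs ! j) / mpoly_eval c e)"
  by (simp add: pencil_def flip: complex_eval_of_real)

lemma real_poly_fun_pencil: "real_poly_fun (pencil c e vs)"
  unfolding pencil_def
  by (intro real_poly_fun.mult real_poly_fun.const real_poly_fun_sum real_poly_fun.coord
      real_poly_fun_subst[OF real_poly_fun_complex_eval])

text \<open>Let b_j > 0 be the imaginary parts and \<beta> their minimum. As the v_j sum to e, the
  sum of the b_j v_j equals \<beta> e plus the sum of the (b_j - \<beta>) v_j; it lies in the open
  cone and so is a hyperbolicity direction by \<open>hyp_dir_change\<close>.\<close>

lemma stable_poly_pencil:
  assumes hyp: "hyperbolic c d e" and vs: "vs \<noteq> []" "\<forall>v\<in>set vs. v \<in> hyp_cone c e" "sum_list vs = e"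
  shows "stable_poly (length vs) d (pencil c e vs)"
proof
  let ?m = "length vs" and ?F = "complex_eval c" and ?E = "\<lambda>i. e $ i"
  have h: "homogeneous_poly c d" and e: "mpoly_eval c e \<noteq> 0"
    using hyp unfolding hyperbolic_def by auto
  note F = real_poly_fun_complex_eval[of c] homog_complex_eval[OF h] hyp_dir_complex_eval[OF hyp]
  have e_sum: "(\<Sum>j<?m. vs ! j) = e"
    using vs(3) by (simp add: sum_list_sum_nth lessThan_atLeast0)
  then have e_nth: "(\<Sum>j<?m. vs ! j $ i) = e $ i" for i
    by (metis sum_component)
  show "real_poly_fun (pencil c e vs)" by (rule real_poly_fun_pencil)
  show "homog d (pencil c e vs)"
    unfolding homog_def pencil_def
    using homogD[OF F(2)] by (simp add: sum_distrib_left[symmetric] mult.assoc)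
  show "pencil c e vs X = pencil c e vs Y" if "\<And>l. X (Inl l) = Y (Inl l)" for X Y
    using that by (simp add: pencil_def)
  show "pencil c e vs (\<lambda>k. of_real (one_zero k)) = 1"
    using e unfolding pencil_of_real by (simp add: one_zero_def e_sum)
  show "half_plane_stable ?m (pencil c e vs)"
    unfolding half_plane_stable_def
  proof (intro allI impI, elim conjE)
    fix X :: "coord \<Rightarrow> complex"
    assume X: "\<forall>j<?m. Im (X (Inl j)) > 0"
    define b where "b j = Im (X (Inl j))" for j
    define \<beta> where "\<beta> = Min (b ` {..<?m})"
    have "\<beta> \<in> b ` {..<?m}" unfolding \<beta>_def using vs(1) by (intro Min_in) auto
    then have \<beta>: "\<beta> > 0" using X by (auto simp: b_def)
    have b: "b j \<ge> \<beta>" if "j < ?m" for j unfolding \<beta>_def using that by (intro Min_le) auto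
    have "(\<lambda>i. \<Sum>j<?m. (b j - \<beta>) * vs ! j $ i) \<in> closed_cone ?F ?E"
    proof (rule closed_cone_sum[where F = ?F, OF F])
      fix j assume "j \<in> {..<?m}"
      then show "(\<lambda>i. (b j - \<beta>) * vs ! j $ i) \<in> closed_cone ?F ?E"
        using b[of j] vs(2) hyp_cone_closed_cone[OF hyp, of "vs ! j"]
        by (intro closed_cone_scale[where F = ?F, OF F(2,3)]) auto
    qed
    then have ne: "?F (\<lambda>i. of_real ((\<Sum>j<?m. (b j - \<beta>) * vs ! j $ i) + s * e $ i)) \<noteq> 0" if "s > 0" for s
      using that unfolding closed_cone_def by blast
    have "hyp_dir ?F (\<lambda>i. \<Sum>j<?m. b j * vs ! j $ i)"
    proof (rule hyp_dir_change[where F = ?F, OF F])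
      fix s :: real assume "s \<ge> 0"
      then have "?F (\<lambda>i. of_real ((\<Sum>j<?m. (b j - \<beta>) * vs ! j $ i) + (\<beta> + s) * e $ i)) \<noteq> 0"
        using \<beta> by (intro ne) simp
      moreover have "(\<Sum>j<?m. (b j - \<beta>) * vs ! j $ i) + (\<beta> + s) * e $ i
          = (\<Sum>j<?m. b j * vs ! j $ i) + s * e $ i" for i
        by (simp add: left_diff_distrib sum_subtractf e_nth flip: sum_distrib_left) (simp add: algebra_simps)
      ultimately show "?F (\<lambda>i. of_real ((\<Sum>j<?m. b j * vs ! j $ i) + s * e $ i)) \<noteq> 0"
        by simp
    qed
    from this[unfolded hyp_dir_def, rule_format, of \<i> "\<lambda>i. \<Sum>j<?m. Re (X (Inl j)) * vs ! j $ i"]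
    have "?F (\<lambda>i. of_real (\<Sum>j<?m. Re (X (Inl j)) * vs ! j $ i)
        + \<i> * of_real (\<Sum>j<?m. b j * vs ! j $ i)) \<noteq> 0"
      by simp
    moreover have "of_real (\<Sum>j<?m. Re (X (Inl j)) * vs ! j $ i) + \<i> * of_real (\<Sum>j<?m. b j * vs ! j $ i)
        = (\<Sum>j<?m. X (Inl j) * of_real (vs ! j $ i))" for i
      by (simp add: complex_eq_iff b_def Re_sum Im_sum)
    ultimately show "pencil c e vs X \<noteq> 0"
      using e by (simp add: pencil_def)
  qed
qed

lemma slope_pencil:
  assumes hyp: "hyperbolic c d e" and vs: "vs \<noteq> []" "\<forall>v\<in>set vs. v \<in> hyp_cone c e" "sum_list vs = e"
    and j: "j < length vs"
  shows "stable_poly.slope (pencil c e vs) j = hyp_trace c e (vs ! j)"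
proof -
  interpret stable_poly "length vs" d "pencil c e vs"
    by (rule stable_poly_pencil[OF assms(1-4)])
  have e: "mpoly_eval c e \<noteq> 0" using hyp unfolding hyperbolic_def by auto
  have e_sum: "(\<Sum>j<length vs. vs ! j) = e"
    using vs(3) by (simp add: sum_list_sum_nth lessThan_atLeast0)
  have eq: "(\<Sum>l<length vs. (one_zero(Inl j := \<sigma>)) (Inl l) *\<^sub>R vs ! l) = e + (\<sigma> - 1) *\<^sub>R vs ! j" for \<sigma>
  proof -
    have "(\<Sum>l<length vs. (one_zero(Inl j := \<sigma>)) (Inl l) *\<^sub>R vs ! l)
        = (\<Sum>l<length vs. vs ! l + (if l = j then (\<sigma> - 1) *\<^sub>R vs ! j else 0))"
      by (rule sum.cong) (auto simp: one_zero_def algebra_simps)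
    then show ?thesis using j by (simp add: sum.distrib e_sum)
  qed
  have "((\<lambda>\<sigma>. mpoly_eval c (e + (\<sigma> - 1) *\<^sub>R vs ! j) / mpoly_eval c e) has_real_derivative slope j) (at 1)"
    using has_real_derivative_pd[OF poly_H, of one_zero "Inl j"]
    unfolding slope_def pencil_of_real eq by (simp add: one_zero_def)
  moreover have "((\<lambda>\<sigma>. mpoly_eval c (e + (\<sigma> - 1) *\<^sub>R vs ! j) / mpoly_eval c e) has_real_derivative
      hyp_trace c e (vs ! j)) (at 1)"
  proof -
    have "((\<lambda>\<sigma> :: real. \<sigma> - 1) has_real_derivative 1) (at 1)"
      by (auto intro!: derivative_eq_intros)
    from DERIV_chain2[OF _ this, of "\<lambda>s. mpoly_eval c (e + s *\<^sub>R vs ! j)" "mpoly_eval c e * hyp_trace c e (vs ! j)"]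
    have "((\<lambda>\<sigma>. mpoly_eval c (e + (\<sigma> - 1) *\<^sub>R vs ! j)) has_real_derivative
        mpoly_eval c e * hyp_trace c e (vs ! j)) (at 1)"
      using trace_derivative[OF hyp] by simp
    from DERIV_cdivide[OF this, of "mpoly_eval c e"] show ?thesis using e by simp
  qed
  ultimately show ?thesis by (rule DERIV_unique)
qed

text \<open>On the span, differentiation along v_k is differentiation in z_k. The induction runs
  downwards because \<open>mixed_op\<close> applies the last vector first, and z is arbitrary
  because the derivative needs the equality at neighbouring points.\<close>

lemma mixed_op_pencil:
  assumes e: "mpoly_eval c e \<noteq> 0"
  shows "k \<le> length vs \<Longrightarrow> mixed_op (drop k vs) (mpoly_eval c) (\<Sum>j<length vs. z j *\<^sub>R vs ! j)
    = mpoly_eval c e * Re (foldr mop [k..<length vs] (pencil c e vs) (\<lambda>l. of_real (case_sum z (\<lambda>_. 1) l)))"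
proof (induction k arbitrary: z rule: inc_induct)
  case base
  then show ?case using e by (simp add: mixed_op_def pencil_of_real)
next
  case (step k)
  let ?m = "length vs" and ?g = "mixed_op (drop (Suc k) vs) (mpoly_eval c)"
  define F where "F = foldr mop [Suc k..<?m] (pencil c e vs)"
  define Z where "Z = case_sum z (\<lambda>_ :: nat. 1 :: real)"
  have F: "real_poly_fun F"
    unfolding F_def by (intro real_poly_fun_mops real_poly_fun_pencil)
  have g: "?g (\<Sum>j<?m. z j *\<^sub>R vs ! j + (if j = k then s *\<^sub>R vs ! k else 0))
      = mpoly_eval c e * Re (F (\<lambda>l. of_real ((Z(Inl k := z k + s)) l)))" for s
  proof -
    have "(\<Sum>j<?m. z j *\<^sub>R vs ! j + (if j = k then s *\<^sub>R vs ! k else 0)) = (\<Sum>j<?m. (z(k := z k + s)) j *\<^sub>R vs ! j)"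
      by (rule sum.cong) (auto simp: algebra_simps)
    moreover have "case_sum (z(k := z k + s)) (\<lambda>_. 1) = Z(Inl k := z k + s)"
      by (auto simp: Z_def split: sum.split)
    ultimately show ?thesis using step.IH[of "z(k := z k + s)"] by (simp add: F_def)
  qed
  have x: "(\<Sum>j<?m. z j *\<^sub>R vs ! j + (if j = k then s *\<^sub>R vs ! k else 0)) = (\<Sum>j<?m. z j *\<^sub>R vs ! j) + s *\<^sub>R vs ! k" for s
    using step.hyps by (simp add: sum.distrib)
  have "((\<lambda>s. Re (F (\<lambda>l. of_real ((Z(Inl k := z k + s)) l)))) has_real_derivative
      Re (pd (Inl k) F (\<lambda>l. of_real (Z l)))) (at 0)"
  proof -
    have "((\<lambda>s. z k + s) has_real_derivative 1) (at 0)"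
      by (auto intro!: derivative_eq_intros)
    from DERIV_chain2[OF _ this, of "\<lambda>\<sigma>. Re (F (\<lambda>l. of_real ((Z(Inl k := \<sigma>)) l)))"]
    show ?thesis using has_real_derivative_pd[OF F, of Z "Inl k"] by (simp add: Z_def)
  qed
  then have "((\<lambda>s. ?g ((\<Sum>j<?m. z j *\<^sub>R vs ! j) + s *\<^sub>R vs ! k)) has_real_derivative
      mpoly_eval c e * Re (pd (Inl k) F (\<lambda>l. of_real (Z l)))) (at 0)"
    unfolding x[symmetric] g by (rule DERIV_cmult)
  then have "dir_deriv (vs ! k) ?g (\<Sum>j<?m. z j *\<^sub>R vs ! j)
      = mpoly_eval c e * Re (pd (Inl k) F (\<lambda>l. of_real (Z l)))"
    unfolding dir_deriv_def by (rule DERIV_imp_deriv)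
  moreover have "?g (\<Sum>j<?m. z j *\<^sub>R vs ! j) = mpoly_eval c e * Re (F (\<lambda>l. of_real (Z l)))"
    using step.IH[of z] by (simp add: F_def Z_def)
  moreover have "drop k vs = vs ! k # drop (Suc k) vs"
    using step.hyps by (simp add: Cons_nth_drop_Suc)
  moreover have "[k..<?m] = k # [Suc k..<?m]"
    using step.hyps by (simp add: upt_conv_Cons)
  ultimately show ?case
    by (simp add: mixed_op_def mop_def[of k] F_def Z_def algebra_simps)
qed

text \<open>For \<epsilon> > 1/m the best choice makes \<nu> equal to q, the square root of the
  target, that is \<mu> = q/(q - 1). For \<epsilon> = 1/m one has q = 1, and the value 1 is obtained
  in the limit of large \<mu>.\<close>

lemma delta_bound_optimal:
  fixes T \<epsilon> :: real and m :: nat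
  assumes m: "m > 0" and \<epsilon>: "\<epsilon> \<ge> 1 / real m"
    and bound: "\<And>\<mu>. \<mu> > 1 \<Longrightarrow> T * (real m - 1 + \<mu>) \<le> real m * \<epsilon> * \<mu> + (real m - 1) * (\<mu> / (\<mu> - 1))"
  shows "T \<le> delta_bound \<epsilon> m"
proof -
  define r where "r = 1 / real m"
  define a where "a = 1 - r"
  define w where "w = sqrt (\<epsilon> - r * a)"
  have r: "r > 0" "real m * r = 1" using m by (simp_all add: r_def)
  have delta: "delta_bound \<epsilon> m = (a + w)\<^sup>2"
    by (simp add: delta_bound_def a_def w_def r_def)
  have "\<epsilon> - r * a \<ge> r\<^sup>2" using \<epsilon> by (simp add: a_def r_def power2_eq_square algebra_simps)
  moreover from this have "\<epsilon> - r * a \<ge> 0" using zero_le_power2[of r] by linarith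
  ultimately have w2: "w\<^sup>2 = \<epsilon> - r * a" and w: "w \<ge> r"
    by (auto simp: w_def intro: real_le_rsqrt)
  show ?thesis
  proof (cases "w > r")
    case True
    define q where "q = a + w"
    have q: "q > 1" using True by (simp add: q_def a_def)
    define \<mu> where "\<mu> = q / (q - 1)"
    have \<mu>: "\<mu> > 1" "\<mu> / (\<mu> - 1) = q" using q by (auto simp: \<mu>_def field_simps)
    have "T * (real m - 1 + \<mu>) \<le> real m * \<epsilon> * \<mu> + (real m - 1) * q"
      using bound[OF \<mu>(1)] unfolding \<mu>(2) .
    then have "(r * (q - 1)) * (T * (real m - 1 + \<mu>)) \<le> (r * (q - 1)) * (real m * \<epsilon> * \<mu> + (real m - 1) * q)"
      using r q by (intro mult_left_mono) auto
    moreover have "(q - 1) * \<mu> = q" using q by (simp add: \<mu>_def)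
    moreover have "(r * (q - 1)) * (T * (real m - 1 + \<mu>))
        = T * ((real m * r) * (q - 1) - r * (q - 1) + r * ((q - 1) * \<mu>))"
      by (simp add: algebra_simps)
    moreover have "(r * (q - 1)) * (real m * \<epsilon> * \<mu> + (real m - 1) * q)
        = (real m * r) * \<epsilon> * ((q - 1) * \<mu>) + ((real m * r) - r) * q * (q - 1)"
      by (simp add: algebra_simps)
    ultimately have "T * ((q - 1) - r * (q - 1) + r * q) \<le> \<epsilon> * q + (1 - r) * q * (q - 1)"
      unfolding r(2) by simp
    moreover have "(q - 1) - r * (q - 1) + r * q = w"
      by (simp add: q_def a_def algebra_simps)
    moreover have "\<epsilon> * q + (1 - r) * q * (q - 1) = w * q\<^sup>2"
    proof -
      have "\<epsilon> = w\<^sup>2 + r * a" using w2 by simp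
      then show ?thesis
        by (simp only:) (simp add: q_def a_def power2_eq_square algebra_simps)
    qed
    ultimately have "w * T \<le> w * q\<^sup>2" by (simp add: mult.commute)
    then show ?thesis using True r by (simp add: delta q_def)
  next
    case False
    then have wr: "w = r" using w by simp
    then have "\<epsilon> = r" using w2 by (simp add: a_def power2_eq_square algebra_simps)
    then have m\<epsilon>: "real m * \<epsilon> = 1" using r by simp
    have "T \<le> 1"
    proof (rule ccontr)
      assume "\<not> T \<le> 1"
      \<comment> \<open>The choice makes (T - 1) x exceed m - 1, which contradicts the bound at
        \<mu> = 1 + x.\<close>
      define x where "x = 1 + real m / (T - 1)"
      have T: "T - 1 > 0" using \<open>\<not> T \<le> 1\<close> by simp
      then have x: "x > 1" "(T - 1) * x = T - 1 + real m" using m by (simp_all add: x_def field_simps)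
      have "T * (real m - 1 + (1 + x)) \<le> real m * \<epsilon> * (1 + x) + (real m - 1) * ((1 + x) / x)"
        using bound[of "1 + x"] x by simp
      then have "(T - 1) * (real m + x) \<le> (real m - 1) / x"
        unfolding m\<epsilon> using x by (simp add: field_simps)
      also have "\<dots> \<le> real m - 1" using x(1) m by (simp add: divide_le_eq mult_le_cancel_left1)
      also have "\<dots> < (T - 1) * x" using x(2) T by simp
      also have "\<dots> \<le> (T - 1) * (real m + x)" using T by simp
      finally show False by simp
    qed
    then show ?thesis using wr by (simp add: delta a_def)
  qed
qed

theorem theorem4p5:
  fixes c :: "('n::finite \<Rightarrow> nat) \<Rightarrow> real" and d :: nat and e :: "real^'n"
    and vs :: "(real^'n) list" and \<epsilon> :: real
  assumes "hyperbolic c d e"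
    and "vs \<noteq> []"
    and "\<forall>v\<in>set vs. v \<in> hyp_cone c e"
    and "sum_list vs = e"
    and "\<forall>v\<in>set vs. hyp_trace c e v \<le> \<epsilon>"
  shows "\<forall>t::real. mixed_op vs (mpoly_eval c) (t *\<^sub>R e) = 0 \<longrightarrow> t \<le> delta_bound \<epsilon> (length vs)"
proof (intro allI impI)
  fix t :: real assume zero: "mixed_op vs (mpoly_eval c) (t *\<^sub>R e) = 0"
  let ?m = "length vs"
  interpret stable_poly ?m d "pencil c e vs"
    by (rule stable_poly_pencil[OF assms(1-4)])
  have e: "mpoly_eval c e \<noteq> 0" using assms(1) unfolding hyperbolic_def by auto
  have m: "?m > 0" using assms(2) by simp
  have "(\<Sum>j<?m. t *\<^sub>R vs ! j) = t *\<^sub>R e"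
    using assms(4) by (simp add: sum_list_sum_nth lessThan_atLeast0 flip: scaleR_sum_right)
  then have "Re (G (\<lambda>k. of_real (case_sum (\<lambda>_. t) (\<lambda>_. 1) k))) = 0"
    using mixed_op_pencil[OF e, of 0 vs "\<lambda>_. t"] zero e by (simp add: G_def)
  then have G0: "G (\<lambda>k. of_real (case_sum (\<lambda>_. t) (\<lambda>_. 1) k)) = 0"
    using real_poly_fun_of_real[OF poly_G, of "case_sum (\<lambda>_. t) (\<lambda>_. 1)"] by simp
  have sum_tr: "real d \<le> real ?m * \<epsilon>"
  proof -
    have "(\<Sum>v\<leftarrow>vs. hyp_trace c e v) \<le> (\<Sum>v\<leftarrow>vs. \<epsilon>)"
      using assms(5) by (intro sum_list_mono) auto
    then show ?thesis using sum_hyp_trace[OF assms(1,4)] by (simp add: sum_list_triv)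
  qed
  then have \<epsilon>0: "\<epsilon> \<ge> 0" using m by (smt (verit) of_nat_0_le_iff of_nat_0_less_iff mult_pos_neg)
  have slope: "slope j \<le> \<epsilon>" if "j < ?m" for j
    using slope_pencil[OF assms(1-4) that] assms(5) that by simp
  have bound: "t * (real ?m - 1 + \<mu>) \<le> real ?m * \<epsilon> * \<mu> + (real ?m - 1) * (\<mu> / (\<mu> - 1))" if "\<mu> > 1" for \<mu>
    by (rule largest_root_bound[OF that m \<epsilon>0 slope G0])
  \<comment> \<open>For d = 0 the polynomial G would be the constant 1 and have no zero. So d \<ge>
    1, and the sum of traces gives \<epsilon> \<ge> 1/m, which makes the radicand of the bound at
    least 1/m^2.\<close>
  have "d > 0"
  proof (rule ccontr)
    assume "\<not> d > 0"
    then have d: "d = 0" by simp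
    have "G (\<lambda>k. of_real (one_zero k)) \<noteq> 0" using G_one by simp
    from homog_line_poly[where F = G, OF poly_G homog_G this, of "\<lambda>k. of_real (case_sum (\<lambda>_. t) (\<lambda>_. 1) k)"]
    obtain p where p: "degree p = 0" "lead_coeff p = 1"
      "\<And>r. G (\<lambda>k. of_real (case_sum (\<lambda>_. t) (\<lambda>_. 1) k) + r * of_real (one_zero k)) = poly p r"
      unfolding G_one d by blast
    then show False using p(3)[of 0] G0 by (simp add: poly_0_coeff_0)
  qed
  then have "\<epsilon> \<ge> 1 / real ?m" using sum_tr m by (simp add: field_simps)
  from delta_bound_optimal[OF m this bound] show "t \<le> delta_bound \<epsilon> ?m" .
qed

end
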